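(* Let $s$ and $k$ be positive integers. The number of self-conjugate $(s, s+1, \ldots, s+2k)$-core partitions is equal to the number of symmetric $(s,2k)$-Dyck paths.
   Context: A partition $\lambda=(\lambda_1\ge\lambda_2\ge\cdots)$ is identified with its Young diagram; its conjugate $\lambda'$ is the reflection of the diagram in the main diagonal, and $\lambda$ is self-conjugate if $\lambda=\lambda'$. The hook length of a box is the number of boxes weakly to its right in its row plus those strictly below it in its column. For a positive integer $t$, $\lambda$ is a $t$-core if no box has hook length divisible by $t$; it is a $(t_1,\ldots,t_r)$-core if it is a $t_i$-core for every $i$. For a positive integer $k$ and $s>0$, an $(s,k)$-Dyck path is a lattice path from $(0,0)$ to $(s,0)$ using up steps $(k/2,1)$, down steps $(k/2,-1)$ and horizontal steps $(\ell,0)$ with $\ell$ an integer, $1\le \ell<k$, never going below the $x$-axis. It is symmetric if its reflection about the line $x=s/2$ is itself. *)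

theory Defs
  imports Complex_Main
begin

definition is_partition :: "nat list \<Rightarrow> bool" where
  "is_partition p \<longleftrightarrow> sorted_wrt (\<ge>) p \<and> 0 \<notin> set p"

text \<open>Boxes are pairs (row, column), both counted from 0. A partition is determined by its diagram.\<close>

definition young_diagram :: "nat list \<Rightarrow> (nat \<times> nat) set" where
  "young_diagram p = {(i, j). i < length p \<and> j < p ! i}"

definition conjugate_diagram :: "(nat \<times> nat) set \<Rightarrow> (nat \<times> nat) set" where
  "conjugate_diagram D = prod.swap ` D"

definition self_conjugate :: "nat list \<Rightarrow> bool" where
  "self_conjugate p \<longleftrightarrow> conjugate_diagram (young_diagram p) = young_diagram p"

definition hook_length :: "nat list \<Rightarrow> nat \<times> nat \<Rightarrow> nat" where
  "hook_length p = (\<lambda>(i, j).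
     card {j'. j \<le> j' \<and> (i, j') \<in> young_diagram p} +
     card {i'. i < i' \<and> (i', j) \<in> young_diagram p})"

definition core :: "nat \<Rightarrow> nat list \<Rightarrow> bool" where
  "core t p \<longleftrightarrow> (\<forall>b \<in> young_diagram p. \<not> t dvd hook_length p b)"

definition simultaneous_core :: "nat set \<Rightarrow> nat list \<Rightarrow> bool" where
  "simultaneous_core T p \<longleftrightarrow> (\<forall>t \<in> T. core t p)"

definition dyck_steps :: "nat \<Rightarrow> (real \<times> real) set" where
  "dyck_steps k = {(real k / 2, 1), (real k / 2, - 1)} \<union>
     {(of_int l, 0) | l :: int. 1 \<le> l \<and> l < int k}"

text \<open>A path is the list of its successive vertices, both endpoints included. Thus two paths that
  trace the same curve with different horizontal steps are different. A path stays weakly above the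
  horizontal axis iff all its vertices do, since steps are straight segments.\<close>

definition dyck_path :: "nat \<Rightarrow> nat \<Rightarrow> (real \<times> real) list \<Rightarrow> bool" where
  "dyck_path s k vs \<longleftrightarrow>
     vs \<noteq> [] \<and> hd vs = (0, 0) \<and> last vs = (real s, 0) \<and>
     successively (\<lambda>(x, y) (x', y'). (x' - x, y' - y) \<in> dyck_steps k) vs \<and>
     (\<forall>(x, y) \<in> set vs. 0 \<le> y)"

text \<open>Reflecting in the line \<open>x = s / 2\<close> reverses the order in which the vertices are visited
  from left to right, hence the list reversal.\<close>

definition reflect_path :: "nat \<Rightarrow> (real \<times> real) list \<Rightarrow> (real \<times> real) list" where
  "reflect_path s vs = rev (map (\<lambda>(x, y). (real s - x, y)) vs)"

definition symmetric_dyck_path :: "nat \<Rightarrow> nat \<Rightarrow> (real \<times> real) list \<Rightarrow> bool" where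
  "symmetric_dyck_path s k vs \<longleftrightarrow> dyck_path s k vs \<and> reflect_path s vs = vs"

end

theory Submission imports Defs begin

text \<open>Let \<open>N = s + k\<close> and let \<open>S = {\<lambda>\<^sub>i - i - 1}\<close> be the set of beads of \<open>\<lambda>\<close>. Being a \<open>t\<close>-core means that
  \<open>S\<close> is closed under subtracting \<open>t\<close>, and being self-conjugate means that \<open>z \<in> S\<close> iff \<open>- 1 - z \<notin> S\<close>.
  Sorting the beads by their residue modulo \<open>N\<close> turns \<open>S\<close> into a function \<open>H\<close> on the integers with
  \<open>H (c + N) = H c - 1\<close> and \<open>H (- 1 - c) = 1 - H c\<close>, and the core conditions say exactly that \<open>H\<close>
  varies by at most 1 on every window of length \<open>k\<close>. The two symmetries make \<open>H\<close> vanish in the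
  middle of a period, so \<open>H\<close> is determined by its values on \<open>{0..<s div 2}\<close>, which start with
  \<open>k\<close> values in \<open>{0, 1}\<close>.
  Removing the first value (or the first \<open>k\<close> values) of such a sequence gives a linear recurrence
  for their number, which is solved by numbers of free lattice paths with the Dyck steps.
  On the other side, a symmetric Dyck path is determined by its left half, a path that stays weakly
  above the axis and ends at some \<open>m\<close> with \<open>0 \<le> s - 2 m < 2 k\<close>, and by the reflection principle
  the number of these is also expressed by the numbers of free paths.\<close>

section \<open>Free lattice paths and coarsely Lipschitz sequences\<close>

text \<open>Counts the unconstrained sequences of Dyck steps with parameter \<open>2 * k\<close>
  from the origin to \<open>(n, h)\<close>. Integer arguments let negative abscissae count as 0, so
  the recurrence has no boundary cases. The guard on \<open>k\<close> secures termination.\<close>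

function free_paths :: "nat \<Rightarrow> int \<Rightarrow> int \<Rightarrow> int" where
  "free_paths k n h =
     (if k = 0 \<or> n < 0 then 0
      else (if n = 0 \<and> h = 0 then 1 else 0)
        + free_paths k (n - int k) (h - 1) + free_paths k (n - int k) (h + 1)
        + (\<Sum>l\<in>{1..<2 * k}. free_paths k (n - int l) h))"
  by auto
termination
  by (relation "measure (\<lambda>(k, n, h). nat (n + 1))") auto

declare free_paths.simps [simp del]

lemma free_paths_neg [simp]: "n < 0 \<Longrightarrow> free_paths k n h = 0"
  by (subst free_paths.simps) simp

lemma free_paths_minus: "free_paths k n (- h) = free_paths k n h"
proof (induction k n h rule: free_paths.induct)
  case (1 k n h)
  show ?case
  proof (cases "k = 0 \<or> n < 0")
    case False
    have "free_paths k (n - int k) (- h - 1) = free_paths k (n - int k) (h + 1)"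
      using 1(2)[OF False] by (simp only: minus_add_distrib diff_conv_add_uminus)
    moreover have "free_paths k (n - int k) (- h + 1) = free_paths k (n - int k) (h - 1)"
      using 1(1)[OF False] by simp
    moreover have "(\<Sum>l\<in>{1..<2 * k}. free_paths k (n - int l) (- h))
        = (\<Sum>l\<in>{1..<2 * k}. free_paths k (n - int l) h)"
      using 1(3)[OF False] by (intro sum.cong) auto
    ultimately show ?thesis
      using False by (subst (1 2) free_paths.simps) simp
  qed (subst (1 2) free_paths.simps, simp)
qed

text \<open>Every step advances by at least 1 and rises by at most 1. This disposes of the boundary
  terms of a telescoping sum.\<close>

lemma free_paths_eq_0: "n < h \<Longrightarrow> free_paths k n h = 0"
proof (induction k n h rule: free_paths.induct)
  case (1 k n h)
  show ?case
  proof (cases "k = 0 \<or> n < 0")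
    case False
    have "free_paths k (n - int k) (h - 1) = 0" "free_paths k (n - int k) (h + 1) = 0"
      using 1 False by auto
    moreover have "(\<Sum>l\<in>{1..<2 * k}. free_paths k (n - int l) h) = 0"
      using 1(3)[OF False] 1(4) by (intro sum.neutral) auto
    ultimately show ?thesis
      using False 1(4) by (subst free_paths.simps) auto
  qed (subst free_paths.simps, simp)
qed

section \<open>Counting coarsely Lipschitz sequences by removing initial values\<close>

definition coarse :: "nat \<Rightarrow> nat \<Rightarrow> (nat \<Rightarrow> int) set" where
  "coarse k M = {h. (\<forall>i\<ge>M. h i = 0) \<and> (\<forall>i j. i \<le> j \<longrightarrow> j \<le> i + k \<longrightarrow> \<bar>h i - h j\<bar> \<le> 1)}"

text \<open>Any two of the first \<open>k\<close> values of a coarse sequence differ by at most 1,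
  so they lie in \<open>{a, a + 1}\<close> or in \<open>{a - 1, a}\<close> with
  \<open>a = h 0\<close>. This is the first case; negating the sequence turns the second into the
  first, so the recurrence can stay inside one family.\<close>

definition coarse_at :: "nat \<Rightarrow> nat \<Rightarrow> int \<Rightarrow> (nat \<Rightarrow> int) set" where
  "coarse_at k M a = {h \<in> coarse k M. h 0 = a \<and> (\<forall>i<k. h i = a \<or> h i = a + 1)}"

lemma coarse_uminus: "(\<lambda>i. - h i) \<in> coarse k M \<longleftrightarrow> h \<in> coarse k M"
  unfolding coarse_def by (simp add: abs_le_iff) (smt (verit))

lemma coarse_at_uminus_iff:
  "uminus \<circ> h \<in> coarse_at k M (- a - 1) \<longleftrightarrow>
    h \<in> coarse k M \<and> h 0 = a + 1 \<and> (\<forall>i<k. h i = a \<or> h i = a + 1)"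
  unfolding coarse_at_def using coarse_uminus[of h k M] by (auto simp: o_def)

text \<open>Prepending a value creates only the windows that start at it, and these reach the first
  \<open>k\<close> entries of \<open>t\<close>.\<close>

lemma coarse_case_nat:
  "case_nat a t \<in> coarse k (Suc M) \<longleftrightarrow> t \<in> coarse k M \<and> (\<forall>i<k. \<bar>a - t i\<bar> \<le> 1)"
proof
  assume h: "case_nat a t \<in> coarse k (Suc M)"
  let ?h = "case_nat a t"
  have L: "\<bar>?h i - ?h j\<bar> \<le> 1" if "i \<le> j" "j \<le> i + k" for i j
    using h that unfolding coarse_def by blast
  have "t i = 0" if "i \<ge> M" for i
  proof -
    have "?h (Suc i) = 0" using h that unfolding coarse_def by blast
    thus ?thesis by simp
  qed
  moreover have "\<bar>t i - t j\<bar> \<le> 1" if "i \<le> j" "j \<le> i + k" for i j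
    using L[of "Suc i" "Suc j"] that by simp
  moreover have "\<bar>a - t i\<bar> \<le> 1" if "i < k" for i
    using L[of 0 "Suc i"] that by simp
  ultimately show "t \<in> coarse k M \<and> (\<forall>i<k. \<bar>a - t i\<bar> \<le> 1)"
    unfolding coarse_def by auto
next
  assume "t \<in> coarse k M \<and> (\<forall>i<k. \<bar>a - t i\<bar> \<le> 1)"
  then show "case_nat a t \<in> coarse k (Suc M)"
    unfolding coarse_def by (auto split: nat.split)
qed

definition plateau :: "nat \<Rightarrow> int \<Rightarrow> (nat \<Rightarrow> int) \<Rightarrow> nat \<Rightarrow> int" where
  "plateau k a t = (\<lambda>i. if i < k then a else t (i - k))"

lemma coarse_at_0: "k > 0 \<Longrightarrow> coarse_at k 0 a = (if a = 0 then {\<lambda>_. 0} else {})"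
  unfolding coarse_at_def coarse_def by auto

lemma case_nat_shift: "case_nat (h 0) (\<lambda>i. h (Suc i)) = h"
  by (auto simp: fun_eq_iff split: nat.split)

lemma coarse_at_case_nat_same:
  assumes "k > 0" "t \<in> coarse_at k M a"
  shows "case_nat a t \<in> coarse_at k (Suc M) a"
  using assms unfolding coarse_at_def
  by (auto simp: coarse_case_nat split: nat.split)

lemma coarse_at_case_nat_up:
  assumes "k > 0" "uminus \<circ> t \<in> coarse_at k M (- a - 1)"
  shows "case_nat a t \<in> coarse_at k (Suc M) a"
proof -
  have tC: "t \<in> coarse k M" and t: "\<And>i. i < k \<Longrightarrow> t i = a \<or> t i = a + 1"
    using assms(2) unfolding coarse_at_uminus_iff by blast+
  have "\<bar>a - t i\<bar> \<le> 1" if "i < k" for i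
    using t[OF that] by auto
  moreover have "case_nat a t i = a \<or> case_nat a t i = a + 1" if "i < k" for i
    using t[of "i - 1"] that by (cases i) auto
  ultimately show ?thesis
    using tC assms(1) unfolding coarse_at_def by (simp add: coarse_case_nat)
qed

lemma coarse_at_plateau:
  assumes "k > 0" "k \<le> M" "t \<in> coarse_at k (M - k) (a - 1)"
  shows "plateau k a t \<in> coarse_at k M a"
proof -
  have t: "\<And>i. i \<ge> M - k \<Longrightarrow> t i = 0" "\<And>i j. i \<le> j \<Longrightarrow> j \<le> i + k \<Longrightarrow> \<bar>t i - t j\<bar> \<le> 1"
    "\<And>i. i < k \<Longrightarrow> t i = a - 1 \<or> t i = a"
    using assms(3) unfolding coarse_at_def coarse_def by auto
  have "\<bar>plateau k a t i - plateau k a t j\<bar> \<le> 1" if "i \<le> j" "j \<le> i + k" for i j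
  proof -
    consider "j < k" | "i < k" "j \<ge> k" | "i \<ge> k" "j \<ge> k" using \<open>i \<le> j\<close> by linarith
    thus ?thesis
    proof cases
      case 2
      \<comment> \<open>The index \<open>j - k\<close> is at most \<open>i\<close>, hence below
        \<open>k\<close>.\<close>
      hence "t (j - k) = a - 1 \<or> t (j - k) = a" using t(3)[of "j - k"] that by linarith
      thus ?thesis using 2 unfolding plateau_def by auto
    next
      case 3
      thus ?thesis using t(2)[of "i - k" "j - k"] that unfolding plateau_def by auto
    qed (use that in \<open>auto simp: plateau_def\<close>)
  qed
  thus ?thesis
    using assms(1,2) t(1) unfolding coarse_at_def coarse_def by (auto simp: plateau_def)
qed

text \<open>The value \<open>h k\<close> decides. If it is \<open>a - 1\<close>, all earlier values
  are within distance \<open>k\<close> of it and must equal \<open>a\<close>, so a whole block of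
  \<open>k\<close> values is removed. Otherwise \<open>h 1, ..., h k\<close> lie in
  \<open>{a, a + 1}\<close>, so removing one value leaves a member of the family or the negation of
  one, according to \<open>h 1\<close>.\<close>

lemma coarse_at_Suc_cases:
  assumes k: "k > 0" and h: "h \<in> coarse_at k (Suc M) a"
  obtains (same) t where "t \<in> coarse_at k M a" "h = case_nat a t"
  | (up) t where "uminus \<circ> t \<in> coarse_at k M (- a - 1)" "h = case_nat a t"
  | (down) t where "k \<le> Suc M" "t \<in> coarse_at k (Suc M - k) (a - 1)" "h = plateau k a t"
proof -
  have h0: "h 0 = a" and hk: "\<And>i. i < k \<Longrightarrow> h i = a \<or> h i = a + 1"
    and hC: "h \<in> coarse k (Suc M)"
    using h unfolding coarse_at_def by auto
  have L: "\<bar>h i - h j\<bar> \<le> 1" if "i \<le> j" "j \<le> i + k" for i j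
    using hC that unfolding coarse_def by blast
  have Z: "h i = 0" if "i \<ge> Suc M" for i
    using hC that unfolding coarse_def by blast
  define t where "t = (\<lambda>i. h (Suc i))"
  have ht: "h = case_nat a t" using case_nat_shift[of h] h0 unfolding t_def by simp
  have tC: "t \<in> coarse k M" using hC coarse_case_nat ht by metis
  have hkk: "h k = a - 1 \<or> h k = a \<or> h k = a + 1" using L[of 0 k] h0 by auto
  show thesis
  proof (cases "h k = a - 1")
    case True
    have flat: "h i = a" if "i < k" for i
      using L[of i k] hk[OF that] True that by auto
    \<comment> \<open>Beyond the support both \<open>h (k - 1)\<close> and \<open>h k\<close> would
      be 0, so there could be no drop from \<open>a\<close> to \<open>a - 1\<close>.\<close>
    have "k \<le> Suc M"
    proof (rule ccontr)
      assume "\<not> k \<le> Suc M"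
      hence "h (k - 1) = 0" "h k = 0" using Z by auto
      thus False using flat[of "k - 1"] True k by auto
    qed
    define u where "u = (\<lambda>i. h (i + k))"
    have "h = plateau k a u" using flat by (auto simp: fun_eq_iff plateau_def u_def)
    moreover have "u \<in> coarse_at k (Suc M - k) (a - 1)"
    proof -
      \<comment> \<open>The index \<open>i + k\<close> shares a window with both
        \<open>k - 1\<close> and \<open>k\<close>, where \<open>h\<close> takes the values
        \<open>a\<close> and \<open>a - 1\<close>.\<close>
      have "u i = a - 1 \<or> u i = a" if "i < k" for i
      proof -
        have "\<bar>h (k - 1) - h (i + k)\<bar> \<le> 1" "\<bar>h k - h (i + k)\<bar> \<le> 1"
          using L[of "k - 1" "i + k"] L[of k "i + k"] that k by auto
        thus ?thesis using flat[of "k - 1"] True k unfolding u_def by auto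
      qed
      moreover have "\<bar>u i - u j\<bar> \<le> 1" if "i \<le> j" "j \<le> i + k" for i j
        using L[of "i + k" "j + k"] that unfolding u_def by auto
      ultimately show ?thesis
        using Z True unfolding coarse_at_def coarse_def u_def by auto
    qed
    ultimately show thesis using down[of u] \<open>k \<le> Suc M\<close> by blast
  next
    case False
    have hk': "t i = a \<or> t i = a + 1" if "i < k" for i
      using hk[of "Suc i"] hkk False that unfolding t_def
      by (cases "Suc i = k") auto
    consider "t 0 = a" | "t 0 = a + 1" using hk'[of 0] k by blast
    thus thesis
    proof cases
      case 1
      thus thesis using same[of t] tC hk' ht unfolding coarse_at_def by auto
    next
      case 2
      thus thesis using up[of t] tC hk' ht unfolding coarse_at_uminus_iff by auto
    qed
  qed
qed

lemma coarse_at_Suc: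
  assumes "k > 0"
  shows "coarse_at k (Suc M) a =
    case_nat a ` coarse_at k M a \<union> (\<lambda>t. case_nat a (uminus \<circ> t)) ` coarse_at k M (- a - 1)
    \<union> (if k \<le> Suc M then plateau k a ` coarse_at k (Suc M - k) (a - 1) else {})"
    (is "?L = ?A \<union> ?B \<union> ?C")
proof
  show "?L \<subseteq> ?A \<union> ?B \<union> ?C"
  proof
    fix h assume "h \<in> ?L"
    with assms show "h \<in> ?A \<union> ?B \<union> ?C"
    proof (cases rule: coarse_at_Suc_cases)
      case (up t)
      have "h = case_nat a (uminus \<circ> (uminus \<circ> t))" using up(2) by (simp add: o_def)
      thus ?thesis using up(1) by blast
    qed auto
  qed
  show "?A \<union> ?B \<union> ?C \<subseteq> ?L"
    using coarse_at_case_nat_same[OF assms] coarse_at_case_nat_up[OF assms]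
      coarse_at_plateau[OF assms, of "Suc M"]
    by (auto simp: o_def)
qed

lemma finite_coarse_at: "k > 0 \<Longrightarrow> finite (coarse_at k M a)"
proof (induction M arbitrary: a rule: less_induct)
  case (less M)
  show ?case
    by (cases M) (use less in \<open>auto simp: coarse_at_0 coarse_at_Suc\<close>)
qed

lemma inj_case_nat: "inj (case_nat a)"
  by (rule injI) (metis nat.case(2) ext)

lemma inj_uminus_comp: "inj ((\<circ>) (uminus :: int \<Rightarrow> int))"
  by (rule injI) (auto simp: fun_eq_iff)

lemma inj_plateau: "inj (plateau k a)"
proof (rule injI)
  fix t u assume eq: "plateau k a t = plateau k a u"
  show "t = u"
  proof
    fix i show "t i = u i" using fun_cong[OF eq, of "i + k"] by (simp add: plateau_def)
  qed
qed

text \<open>The three kinds of sequences are told apart by \<open>h k\<close> and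
  \<open>h 1\<close>: only block removal has \<open>h k = a - 1\<close>, and the other two have
  \<open>h 1 = a\<close> and \<open>h 1 = a + 1\<close>.\<close>

lemma card_coarse_at_Suc:
  assumes k: "k > 0"
  shows "card (coarse_at k (Suc M) a) = card (coarse_at k M a) + card (coarse_at k M (- a - 1))
    + (if k \<le> Suc M then card (coarse_at k (Suc M - k) (a - 1)) else 0)"
proof -
  let ?A = "case_nat a ` coarse_at k M a"
  let ?B = "(\<lambda>t. case_nat a (uminus \<circ> t)) ` coarse_at k M (- a - 1)"
  let ?C = "if k \<le> Suc M then plateau k a ` coarse_at k (Suc M - k) (a - 1) else {}"
  have k1: "case_nat a t k = t (k - 1)" for t
    using k by (cases k) auto
  have A: "h (Suc 0) = a \<and> h k \<noteq> a - 1" if "h \<in> ?A" for h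
  proof -
    from that obtain t where t: "t \<in> coarse_at k M a" "h = case_nat a t" by blast
    have "t (k - 1) = a \<or> t (k - 1) = a + 1" "t 0 = a"
      using t(1) k unfolding coarse_at_def by auto
    thus ?thesis unfolding t(2) k1 by auto
  qed
  have B: "h (Suc 0) = a + 1 \<and> h k \<noteq> a - 1" if "h \<in> ?B" for h
  proof -
    from that obtain t where t: "t \<in> coarse_at k M (- a - 1)" "h = case_nat a (uminus \<circ> t)"
      by blast
    have "t (k - 1) = - a - 1 \<or> t (k - 1) = - a" "t 0 = - a - 1"
      using t(1) k unfolding coarse_at_def by auto
    thus ?thesis unfolding t(2) k1 by auto
  qed
  have C: "h k = a - 1" if "h \<in> ?C" for h
    using that k by (auto simp: coarse_at_def plateau_def split: if_splits)
  have "h \<notin> ?B" if "h \<in> ?A" for h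
    using A[OF that] B[of h] by force
  hence "?A \<inter> ?B = {}" by (intro disjoint_iff[THEN iffD2] allI impI)
  moreover have "h \<notin> ?C" if "h \<in> ?A \<union> ?B" for h
    using that
  proof
    assume "h \<in> ?A"
    thus ?thesis using A[of h] C[of h] by argo
  next
    assume "h \<in> ?B"
    thus ?thesis using B[of h] C[of h] by argo
  qed
  hence "(?A \<union> ?B) \<inter> ?C = {}" by (intro disjoint_iff[THEN iffD2] allI impI)
  moreover have "finite ?A" "finite ?B" "finite ?C"
    using finite_coarse_at[OF k] by auto
  ultimately have "card (coarse_at k (Suc M) a) = card ?A + card ?B + card ?C"
    unfolding coarse_at_Suc[OF k] by (simp only: card_Un_disjoint finite_Un simp_thms)
  moreover have "card ?A = card (coarse_at k M a)"
    by (rule card_image) (rule inj_on_subset[OF inj_case_nat subset_UNIV])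
  moreover have "card ?B = card (coarse_at k M (- a - 1))"
    by (rule card_image, rule inj_on_subset[OF _ subset_UNIV])
      (use inj_compose[OF inj_case_nat inj_uminus_comp] in \<open>simp add: o_def\<close>)
  moreover have "card (plateau k a ` coarse_at k (Suc M - k) (a - 1))
      = card (coarse_at k (Suc M - k) (a - 1))"
    by (rule card_image) (rule inj_on_subset[OF inj_plateau subset_UNIV])
  ultimately show ?thesis by auto
qed

text \<open>The right-hand side obeys the same recurrence. Its three terms contribute free paths of
  height \<open>a\<close> at distances 1 to \<open>2 * k - 1\<close>, of height \<open>a - 1\<close>
  at distance \<open>k\<close>, and of height \<open>a + 1\<close> at distances 1 to
  \<open>k\<close>. The very last one completes the step recurrence of \<open>free_paths\<close>;
  the others of height \<open>a + 1\<close> are the correction sum.\<close>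

lemma card_coarse_at:
  assumes k: "k > 0"
  shows "int (card (coarse_at k M a))
    = free_paths k (int M) a + (\<Sum>i\<in>{1..<k}. free_paths k (int M - int i) (a + 1))"
proof (induction M arbitrary: a rule: less_induct)
  case (less M)
  show ?case
  proof (cases M)
    case 0
    thus ?thesis using k
      by (subst free_paths.simps) (simp add: coarse_at_0)
  next
    case (Suc n)
    let ?P = "\<lambda>i b. free_paths k (int n + 1 - int i) b"
    have IH1: "int (card (coarse_at k n a)) = (\<Sum>i\<in>{1..<k}. ?P (i + 1) (a + 1)) + ?P 1 a"
      using less[of n a] Suc by (simp add: algebra_simps)
    have "- a - 1 = - (a + 1)" by simp
    hence neg: "free_paths k (int n) (- a - 1) = free_paths k (int n) (a + 1)"
      by (simp only: free_paths_minus)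
    have IH2: "int (card (coarse_at k n (- a - 1)))
        = ?P 1 (a + 1) + (\<Sum>i\<in>{1..<k}. ?P (i + 1) a)"
      using less[of n "- a - 1"] Suc neg free_paths_minus[of k _ a]
      by (simp add: algebra_simps)
    \<comment> \<open>For \<open>k > Suc n\<close> all abscissae on the right are negative and the
      terms vanish, which matches the \<open>else\<close> branch.\<close>
    have IH3: "(if k \<le> Suc n then int (card (coarse_at k (Suc n - k) (a - 1))) else 0)
        = ?P k (a - 1) + (\<Sum>i\<in>{1..<k}. ?P (k + i) a)"
      using less[of "Suc n - k" "a - 1"] Suc k by (auto simp: algebra_simps of_nat_diff)
    have shift: "?P 1 b + (\<Sum>i\<in>{1..<k}. ?P (i + 1) b) = (\<Sum>i\<in>{1..<k}. ?P i b) + ?P k b" for b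
    proof -
      have "?P 1 b + (\<Sum>i\<in>{1..<k}. ?P (i + 1) b) = (\<Sum>i\<in>{1..<Suc k}. ?P i b)"
        using k sum.shift_bounds_Suc_ivl[of "\<lambda>i. ?P i b" 1 k]
          sum.atLeast_Suc_lessThan[of 1 "Suc k" "\<lambda>i. ?P i b"] by simp
      thus ?thesis using k by simp
    qed
    have split: "(\<Sum>i\<in>{1..<2 * k}. ?P i a)
        = (\<Sum>i\<in>{1..<k}. ?P i a) + ?P k a + (\<Sum>i\<in>{1..<k}. ?P (k + i) a)"
    proof -
      have "(\<Sum>i\<in>{1..<2 * k}. ?P i a) = (\<Sum>i\<in>{1..<Suc k}. ?P i a) + (\<Sum>i\<in>{Suc k..<2 * k}. ?P i a)"
        using k by (intro sum.atLeastLessThan_concat[symmetric]) auto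
      moreover have "(\<Sum>i\<in>{Suc k..<2 * k}. ?P i a) = (\<Sum>i\<in>{1..<k}. ?P (k + i) a)"
        using sum.shift_bounds_nat_ivl[of "\<lambda>i. ?P i a" 1 k k] by (simp add: add.commute mult_2)
      ultimately show ?thesis using k by simp
    qed
    have if_int: "int (if c then x else 0) = (if c then int x else 0)" for c x
      by simp
    have "int (card (coarse_at k M a)) = (\<Sum>i\<in>{1..<k}. ?P (i + 1) (a + 1)) + ?P 1 a
        + (?P 1 (a + 1) + (\<Sum>i\<in>{1..<k}. ?P (i + 1) a))
        + (?P k (a - 1) + (\<Sum>i\<in>{1..<k}. ?P (k + i) a))"
      by (simp only: Suc card_coarse_at_Suc[OF k] int_plus if_int IH1 IH2 IH3)
    moreover have "free_paths k (int M) a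
        = ?P k (a - 1) + ?P k (a + 1) + (\<Sum>i\<in>{1..<2 * k}. ?P i a)"
      using k Suc by (subst free_paths.simps) (simp add: algebra_simps)
    ultimately show ?thesis
      using shift[of a] shift[of "a + 1"] split Suc by (simp add: algebra_simps)
  qed
qed

text \<open>The restriction to 0 and 1 makes the continuation of \<open>h\<close> to negative
  \<open>r\<close> by \<open>1 - h (- 1 - r)\<close> coarse as well.\<close>

definition coarse01 :: "nat \<Rightarrow> nat \<Rightarrow> (nat \<Rightarrow> int) set" where
  "coarse01 k M = {h \<in> coarse k M. \<forall>i<k. h i = 0 \<or> h i = 1}"

text \<open>Sequences with \<open>h 0 = 0\<close> form one family, and those with
  \<open>h 0 = 1\<close> are the negations of the family at \<open>- 1\<close>. The leading terms of
  the two counts supply \<open>i = 0\<close>, the correction sums the remaining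
  \<open>i\<close>.\<close>

lemma card_coarse01:
  assumes k: "k > 0"
  shows "int (card (coarse01 k M))
    = (\<Sum>i<k. free_paths k (int M - int i) 0 + free_paths k (int M - int i) 1)"
proof -
  have "coarse01 k M = coarse_at k M 0 \<union> (\<circ>) uminus ` coarse_at k M (- 1)"
  proof (intro equalityI subsetI)
    fix h assume h: "h \<in> coarse01 k M"
    show "h \<in> coarse_at k M 0 \<union> (\<circ>) uminus ` coarse_at k M (- 1)"
    proof (cases "h 0 = 0")
      case True
      thus ?thesis using h unfolding coarse01_def coarse_at_def by auto
    next
      case False
      have "uminus \<circ> h \<in> coarse_at k M (- 1)"
        using coarse_at_uminus_iff[of h k M 0] h k False unfolding coarse01_def by auto
      moreover have "h = uminus \<circ> (uminus \<circ> h)" by (simp add: o_def)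
      ultimately show ?thesis by blast
    qed
  next
    fix h assume "h \<in> coarse_at k M 0 \<union> (\<circ>) uminus ` coarse_at k M (- 1)"
    thus "h \<in> coarse01 k M"
    proof
      assume "h \<in> (\<circ>) uminus ` coarse_at k M (- 1)"
      then obtain u where "u \<in> coarse_at k M (- 1)" "h = uminus \<circ> u" by blast
      hence "uminus \<circ> h \<in> coarse_at k M (- 1)" by (simp add: o_def)
      thus ?thesis using coarse_at_uminus_iff[of h k M 0] unfolding coarse01_def by auto
    qed (auto simp: coarse01_def coarse_at_def)
  qed
  moreover have "coarse_at k M 0 \<inter> (\<circ>) uminus ` coarse_at k M (- 1) = {}"
    unfolding coarse_at_def by auto
  moreover have "card ((\<circ>) uminus ` coarse_at k M (- 1)) = card (coarse_at k M (- 1))"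
    by (rule card_image) (rule inj_on_subset[OF inj_uminus_comp subset_UNIV])
  ultimately have "card (coarse01 k M) = card (coarse_at k M 0) + card (coarse_at k M (- 1))"
    using finite_coarse_at[OF k] by (simp add: card_Un_disjoint)
  moreover have "{..<k} = insert 0 {1..<k}" using k by auto
  ultimately show ?thesis
    using card_coarse_at[OF k, of M 0] card_coarse_at[OF k, of M "- 1"] free_paths_minus[of k _ 1]
    by (simp add: sum.distrib)
qed

section \<open>Symmetric Dyck paths\<close>

abbreviation dyck_edge :: "nat \<Rightarrow> real \<times> real \<Rightarrow> real \<times> real \<Rightarrow> bool" where
  "dyck_edge k \<equiv> \<lambda>(x, y) (x', y'). (x' - x, y' - y) \<in> dyck_steps k"

definition dyck_prefix :: "nat \<Rightarrow> (real \<times> real) list \<Rightarrow> bool" where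
  "dyck_prefix k us \<longleftrightarrow>
     us \<noteq> [] \<and> hd us = (0, 0) \<and> successively (dyck_edge k) us \<and> (\<forall>(x, y) \<in> set us. 0 \<le> y)"

definition prefixes_to :: "nat \<Rightarrow> int \<Rightarrow> int \<Rightarrow> (real \<times> real) list set" where
  "prefixes_to k m h = {us. dyck_prefix (2 * k) us \<and> last us = (of_int m, of_int h)}"

lemma dyck_steps_even_iff:
  "(dx, dy) \<in> dyck_steps (2 * k) \<longleftrightarrow>
     dx = real k \<and> (dy = 1 \<or> dy = - 1) \<or> dy = 0 \<and> (\<exists>l\<in>{1..<2 * k}. dx = real l)"
proof -
  have "(\<exists>l. dx = real_of_int l \<and> 1 \<le> l \<and> l < int (2 * k)) \<longleftrightarrow> (\<exists>l\<in>{1..<2 * k}. dx = real l)"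
    (is "?L \<longleftrightarrow> ?R")
  proof
    assume ?L
    then obtain l where "dx = real_of_int l" "1 \<le> l" "l < int (2 * k)" by blast
    thus ?R by (intro bexI[of _ "nat l"]) auto
  next
    assume ?R
    then obtain l where "dx = real l" "l \<in> {1..<2 * k}" by blast
    thus ?L by (intro exI[of _ "int l"]) auto
  qed
  moreover have "(dx, dy) \<in> dyck_steps (2 * k) \<longleftrightarrow>
      dx = real k \<and> (dy = 1 \<or> dy = - 1)
      \<or> dy = 0 \<and> (\<exists>l. dx = real_of_int l \<and> 1 \<le> l \<and> l < int (2 * k))"
    unfolding dyck_steps_def by (simp add: conj_disj_distribL) blast
  ultimately show ?thesis by argo
qed

lemma dyck_prefix_snoc:
  assumes "us \<noteq> []"
  shows "dyck_prefix k (us @ [v]) \<longleftrightarrow> dyck_prefix k us \<and> dyck_edge k (last us) v \<and> 0 \<le> snd v"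
  using assms unfolding dyck_prefix_def
  by (cases v) (auto simp: successively_append_iff)

lemma dyck_prefix_singleton: "dyck_prefix k [v] \<longleftrightarrow> v = (0, 0)"
  unfolding dyck_prefix_def by auto

lemma dyck_prefix_induct [consumes 1, case_names base snoc]:
  assumes "dyck_prefix k us" and "P [(0, 0)]"
    and "\<And>us v. dyck_prefix k us \<Longrightarrow> P us \<Longrightarrow> dyck_edge k (last us) v \<Longrightarrow> 0 \<le> snd v \<Longrightarrow> P (us @ [v])"
  shows "P us"
  using assms(1)
proof (induction us rule: rev_induct)
  case (snoc v us)
  show ?case
  proof (cases "us = []")
    case True
    thus ?thesis using snoc.prems assms(2) by (simp add: dyck_prefix_singleton)
  next
    case False
    have "dyck_prefix k us" "dyck_edge k (last us) v" "0 \<le> snd v"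
      using snoc.prems dyck_prefix_snoc[OF False, of k v] by simp_all
    thus ?thesis using snoc.IH assms(3) by simp
  qed
qed (simp add: dyck_prefix_def)

text \<open>With parameter \<open>2 * k\<close> all steps have integer coordinates, so every vertex
  is a lattice point; each step advances at least as much as it rises.\<close>

lemma dyck_prefix_last:
  assumes "dyck_prefix (2 * k) us" and k: "k > 0"
  obtains m h where "us \<in> prefixes_to k m h" "0 \<le> h" "h \<le> m"
proof -
  have "\<exists>m h. last us = (of_int m, of_int h) \<and> 0 \<le> h \<and> h \<le> m"
    using assms
  proof (induction rule: dyck_prefix_induct)
    case base
    thus ?case by (intro exI[of _ 0]) auto
  next
    case (snoc us v)
    then obtain m h where mh: "last us = (of_int m, of_int h)" "0 \<le> h" "h \<le> m" by blast
    obtain x y where v: "v = (x, y)" by (cases v)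
    have step: "(x - of_int m, y - of_int h) \<in> dyck_steps (2 * k)"
      using snoc.hyps(2) mh v by simp
    consider (up) "x - of_int m = real k" "y - of_int h = 1"
      | (down) "x - of_int m = real k" "y - of_int h = - 1"
      | (flat) l where "l \<in> {1..<2 * k}" "x - of_int m = real l" "y - of_int h = 0"
      using step unfolding dyck_steps_even_iff by blast
    thus ?case
    proof cases
      case up
      thus ?thesis using mh v k
        by (intro exI[of _ "m + int k"] exI[of _ "h + 1"]) auto
    next
      case down
      moreover have "h \<ge> 1" using snoc.hyps(3) v down by auto
      ultimately show ?thesis using mh v k
        by (intro exI[of _ "m + int k"] exI[of _ "h - 1"]) auto
    next
      case flat
      thus ?thesis using mh v
        by (intro exI[of _ "m + int l"] exI[of _ h]) auto
    qed
  qed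
  thus thesis using assms that unfolding prefixes_to_def by blast
qed

lemma prefixes_to_unique:
  "us \<in> prefixes_to k m h \<Longrightarrow> us \<in> prefixes_to k m' h' \<Longrightarrow> m = m' \<and> h = h'"
  unfolding prefixes_to_def by auto

lemma prefixes_to_eq_empty: "k > 0 \<Longrightarrow> h < 0 \<or> m < h \<Longrightarrow> prefixes_to k m h = {}"
proof (rule ccontr)
  assume k: "k > 0" and *: "h < 0 \<or> m < h" "prefixes_to k m h \<noteq> {}"
  then obtain us where us: "us \<in> prefixes_to k m h" by blast
  hence "dyck_prefix (2 * k) us" unfolding prefixes_to_def by blast
  then obtain m' h' where "us \<in> prefixes_to k m' h'" "0 \<le> h'" "h' \<le> m'"
    using k by (rule dyck_prefix_last)
  thus False using prefixes_to_unique[OF us] * by force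
qed

lemma prefixes_to_rec:
  assumes "0 \<le> h"
  shows "prefixes_to k m h = (if m = 0 \<and> h = 0 then {[(0, 0)]} else {})
    \<union> (\<lambda>us. us @ [(of_int m, of_int h)]) `
        (prefixes_to k (m - int k) (h - 1) \<union> prefixes_to k (m - int k) (h + 1)
          \<union> (\<Union>l\<in>{1..<2 * k}. prefixes_to k (m - int l) h))"
    (is "?L = ?B \<union> ?f ` ?R")
proof (intro equalityI subsetI)
  fix us assume us: "us \<in> ?L"
  hence pre: "dyck_prefix (2 * k) us" and lst: "last us = (of_int m, of_int h)"
    unfolding prefixes_to_def by auto
  have "us \<noteq> []" using pre unfolding dyck_prefix_def by blast
  then obtain ws where ws: "us = ws @ [(of_int m, of_int h)]"
    using lst by (metis append_butlast_last_id)
  show "us \<in> ?B \<union> ?f ` ?R"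
  proof (cases "ws = []")
    case True
    thus ?thesis using pre ws by (simp add: dyck_prefix_singleton)
  next
    case False
    hence ws': "dyck_prefix (2 * k) ws" "dyck_edge (2 * k) (last ws) (of_int m, of_int h)"
      using pre dyck_prefix_snoc[OF False, of "2 * k" "(of_int m, of_int h)"] ws by simp_all
    obtain x y where xy: "last ws = (x, y)" by (cases "last ws")
    have "(of_int m - x, of_int h - y) \<in> dyck_steps (2 * k)" using ws'(2) xy by simp
    hence "x = of_int (m - int k) \<and> (y = of_int (h - 1) \<or> y = of_int (h + 1))
        \<or> y = of_int h \<and> (\<exists>l\<in>{1..<2 * k}. x = of_int (m - int l))"
      unfolding dyck_steps_even_iff by (auto simp: algebra_simps)
    hence "ws \<in> ?R" using ws'(1) xy unfolding prefixes_to_def by simp argo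
    thus ?thesis using ws by blast
  qed
next
  fix us assume "us \<in> ?B \<union> ?f ` ?R"
  thus "us \<in> ?L"
  proof
    assume "us \<in> ?B"
    thus ?thesis by (auto simp: prefixes_to_def dyck_prefix_singleton split: if_splits)
  next
    assume "us \<in> ?f ` ?R"
    then obtain ws where ws: "ws \<in> ?R" "us = ws @ [(of_int m, of_int h)]" by blast
    hence "dyck_prefix (2 * k) ws" unfolding prefixes_to_def by blast
    moreover from this have "ws \<noteq> []" unfolding dyck_prefix_def by blast
    moreover have "dyck_edge (2 * k) (last ws) (of_int m, of_int h)"
    proof -
      have "last ws = (of_int m - real k, of_int h - 1) \<or> last ws = (of_int m - real k, of_int h + 1)
          \<or> (\<exists>l\<in>{1..<2 * k}. last ws = (of_int m - real l, of_int h))"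
        using ws(1) unfolding prefixes_to_def by simp blast
      thus ?thesis by (elim disjE bexE) (simp_all add: dyck_steps_even_iff)
    qed
    ultimately show ?thesis
      using assms ws(2) unfolding prefixes_to_def by (simp add: dyck_prefix_snoc)
  qed
qed

lemma finite_prefixes_to: "k > 0 \<Longrightarrow> finite (prefixes_to k m h)"
proof (induction "nat m" arbitrary: m h rule: less_induct)
  case less
  show ?case
  proof (cases "0 \<le> h \<and> h \<le> m")
    case False
    thus ?thesis using prefixes_to_eq_empty[of k h m] less.prems by (auto simp: not_le)
  next
    case True
    have "finite (prefixes_to k (m - int l) h')" if "l > 0" for l h'
    proof (cases "m - int l \<ge> 0")
      case True
      thus ?thesis using less that by auto
    next
      case False
      hence "prefixes_to k (m - int l) h' = {}" using less.prems by (intro prefixes_to_eq_empty) auto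
      thus ?thesis by simp
    qed
    thus ?thesis
      using True less.prems by (subst prefixes_to_rec) auto
  qed
qed

lemma card_prefixes_to_rec:
  assumes "0 \<le> h" and k: "k > 0"
  shows "card (prefixes_to k m h) = (if m = 0 \<and> h = 0 then 1 else 0)
    + card (prefixes_to k (m - int k) (h - 1)) + card (prefixes_to k (m - int k) (h + 1))
    + (\<Sum>l\<in>{1..<2 * k}. card (prefixes_to k (m - int l) h))"
proof -
  let ?f = "\<lambda>us. us @ [(real_of_int m, real_of_int h)]"
  let ?B = "if m = 0 \<and> h = 0 then {[(0 :: real, 0 :: real)]} else {}"
  let ?D = "prefixes_to k (m - int k) (h - 1)"
  let ?U = "prefixes_to k (m - int k) (h + 1)"
  let ?F = "\<lambda>l. prefixes_to k (m - int l) h"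
  note fin = finite_prefixes_to[OF k]
  have dis: "prefixes_to k a b \<inter> prefixes_to k c d = {}" if "a \<noteq> c \<or> b \<noteq> d" for a b c d
    using prefixes_to_unique[of _ k a b c d] that by (intro disjoint_iff[THEN iffD2]) blast
  have F: "card (\<Union>l\<in>{1..<2 * k}. ?F l) = (\<Sum>l\<in>{1..<2 * k}. card (?F l))"
    by (intro card_UN_disjoint ballI impI dis) (simp_all add: fin)
  have "?D \<inter> ?F l = {}" "?U \<inter> ?F l = {}" for l
    by (intro dis; simp)+
  hence "(?D \<union> ?U) \<inter> (\<Union>l\<in>{1..<2 * k}. ?F l) = {}"
    by (simp add: Int_UN_distrib Int_Un_distrib2)
  hence "card (?D \<union> ?U \<union> (\<Union>l\<in>{1..<2 * k}. ?F l))
      = card (?D \<union> ?U) + card (\<Union>l\<in>{1..<2 * k}. ?F l)"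
    by (intro card_Un_disjoint) (simp_all add: fin)
  moreover have "card (?D \<union> ?U) = card ?D + card ?U"
    by (intro card_Un_disjoint fin dis) simp
  moreover have "card (?f ` A) = card A" for A
    by (rule card_image) (auto simp: inj_on_def)
  moreover have "card (prefixes_to k m h)
      = card ?B + card (?f ` (?D \<union> ?U \<union> (\<Union>l\<in>{1..<2 * k}. ?F l)))"
  proof (subst prefixes_to_rec[OF assms(1)], rule card_Un_disjoint)
    show "?B \<inter> ?f ` (?D \<union> ?U \<union> (\<Union>l\<in>{1..<2 * k}. ?F l)) = {}"
      by (auto simp: prefixes_to_def dyck_prefix_def)
  qed (use fin in auto)
  moreover have "card ?B = (if m = 0 \<and> h = 0 then 1 else 0)" by simp
  ultimately show ?thesis using F by simp
qed

text \<open>The reflection principle: the right-hand side satisfies the same recurrence for \<open>h \<ge> 0\<close> and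
  vanishes at \<open>h = - 1\<close>.\<close>

lemma card_prefixes_to:
  assumes k: "k > 0" and "h \<ge> - 1"
  shows "int (card (prefixes_to k m h)) = free_paths k m h - free_paths k m (h + 2)"
  using assms(2)
proof (induction "nat (m + 1)" arbitrary: m h rule: less_induct)
  case less
  show ?case
  proof (cases "h = - 1 \<or> m < 0")
    case True
    hence "prefixes_to k m h = {}"
      using less.prems k by (intro prefixes_to_eq_empty) auto
    thus ?thesis using True free_paths_minus[of k m 1] by auto
  next
    case False
    hence h: "h \<ge> 0" and m: "m \<ge> 0" using less.prems by auto
    \<comment> \<open>For \<open>h = 0\<close> a final up step would start at height
      \<open>- 1\<close>, which is why the induction covers \<open>h \<ge> - 1\<close>.\<close>
    have IH: "int (card (prefixes_to k (m - int l) h'))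
        = free_paths k (m - int l) h' - free_paths k (m - int l) (h' + 2)"
      if "l > 0" "h' \<ge> - 1" for l h'
      using less.hyps[of "m - int l" h'] that m by auto
    have sum: "(\<Sum>l\<in>{1..<2 * k}. int (card (prefixes_to k (m - int l) h)))
        = (\<Sum>l\<in>{1..<2 * k}. free_paths k (m - int l) h)
          - (\<Sum>l\<in>{1..<2 * k}. free_paths k (m - int l) (h + 2))"
      unfolding sum_subtractf[symmetric] using h by (intro sum.cong refl IH) auto
    have rec: "free_paths k m b = (if m = 0 \<and> b = 0 then 1 else 0)
        + free_paths k (m - int k) (b - 1) + free_paths k (m - int k) (b + 1)
        + (\<Sum>l\<in>{1..<2 * k}. free_paths k (m - int l) b)" for b
      using k m by (subst free_paths.simps) simp
    have "int (card (prefixes_to k m h)) = (if m = 0 \<and> h = 0 then 1 else 0)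
        + int (card (prefixes_to k (m - int k) (h - 1)))
        + int (card (prefixes_to k (m - int k) (h + 1)))
        + (\<Sum>l\<in>{1..<2 * k}. int (card (prefixes_to k (m - int l) h)))"
      by (subst card_prefixes_to_rec[OF h k, of m]) simp
    moreover have "free_paths k (m - int k) (h - 1 + 2) = free_paths k (m - int k) (h + 2 - 1)"
      "free_paths k (m - int k) (h + 1 + 2) = free_paths k (m - int k) (h + 2 + 1)"
      by (simp_all add: algebra_simps)
    ultimately show ?thesis
      using IH[OF k, of "h - 1"] IH[OF k, of "h + 1"] sum rec[of h] rec[of "h + 2"] h by simp
  qed
qed

definition prefixes_to_abscissa :: "nat \<Rightarrow> int \<Rightarrow> (real \<times> real) list set" where
  "prefixes_to_abscissa k m = {us. dyck_prefix (2 * k) us \<and> fst (last us) = of_int m}"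

lemma prefixes_to_abscissa_eq:
  assumes k: "k > 0"
  shows "prefixes_to_abscissa k m = (\<Union>h\<in>{0..m}. prefixes_to k m h)"
proof (intro equalityI subsetI)
  fix us assume us: "us \<in> prefixes_to_abscissa k m"
  hence "dyck_prefix (2 * k) us" unfolding prefixes_to_abscissa_def by blast
  then obtain m' h where "us \<in> prefixes_to k m' h" "0 \<le> h" "h \<le> m'"
    using k by (rule dyck_prefix_last)
  moreover from this have "m' = m"
    using us unfolding prefixes_to_abscissa_def prefixes_to_def by auto
  ultimately show "us \<in> (\<Union>h\<in>{0..m}. prefixes_to k m h)" by auto
qed (auto simp: prefixes_to_abscissa_def prefixes_to_def)

lemma finite_prefixes_to_abscissa: "k > 0 \<Longrightarrow> finite (prefixes_to_abscissa k m)"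
  by (simp add: prefixes_to_abscissa_eq finite_prefixes_to)

text \<open>Summing the reflection formula over all end heights telescopes with stride 2. The terms
  above height \<open>m\<close> vanish, which leaves those at 0 and 1.\<close>

lemma card_prefixes_to_abscissa:
  assumes "k > 0"
  shows "int (card (prefixes_to_abscissa k m)) = free_paths k m 0 + free_paths k m 1"
proof (cases "m < 0")
  case True
  thus ?thesis unfolding prefixes_to_abscissa_eq[OF assms] by simp
next
  case False
  have "card (prefixes_to_abscissa k m) = (\<Sum>h\<in>{0..m}. card (prefixes_to k m h))"
    unfolding prefixes_to_abscissa_eq[OF assms]
    using prefixes_to_unique finite_prefixes_to[OF assms]
    by (intro card_UN_disjoint) blast+
  hence "int (card (prefixes_to_abscissa k m))
      = (\<Sum>h\<in>{0..m}. free_paths k m h - free_paths k m (h + 2))"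
    by (simp add: card_prefixes_to[OF assms])
  also have "\<dots> = (\<Sum>i\<in>{0..nat m}. free_paths k m (int i) - free_paths k m (int i + 2))"
    using False by (intro sum.reindex_bij_witness[of _ int nat]) auto
  also have "\<dots> = free_paths k m 0 + free_paths k m 1
      - free_paths k m (int (nat m) + 1) - free_paths k m (int (nat m) + 2)"
  proof -
    have "(\<Sum>i\<in>{0..n}. f (int i) - f (int i + 2)) = f 0 + f 1 - f (int n + 1) - f (int n + 2)"
      for n and f :: "int \<Rightarrow> int"
      by (induction n) (auto simp: algebra_simps)
    thus ?thesis .
  qed
  also have "\<dots> = free_paths k m 0 + free_paths k m 1"
    using False by (simp add: free_paths_eq_0)
  finally show ?thesis .
qed

definition half_paths :: "nat \<Rightarrow> nat \<Rightarrow> (real \<times> real) list set" where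
  "half_paths s k = (\<Union>i<k. prefixes_to_abscissa k (int (s div 2) - int i))"

lemma card_half_paths:
  assumes "k > 0"
  shows "int (card (half_paths s k))
    = (\<Sum>i<k. free_paths k (int (s div 2) - int i) 0 + free_paths k (int (s div 2) - int i) 1)"
proof -
  have "card (half_paths s k) = (\<Sum>i<k. card (prefixes_to_abscissa k (int (s div 2) - int i)))"
    unfolding half_paths_def
  proof (rule card_UN_disjoint)
    show "\<forall>i\<in>{..<k}. \<forall>j\<in>{..<k}. i \<noteq> j \<longrightarrow>
        prefixes_to_abscissa k (int (s div 2) - int i)
          \<inter> prefixes_to_abscissa k (int (s div 2) - int j) = {}"
      by (auto simp: prefixes_to_abscissa_def)
  qed (simp_all add: finite_prefixes_to_abscissa[OF assms])
  thus ?thesis by (simp add: card_prefixes_to_abscissa[OF assms])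
qed

text \<open>The distance from the last vertex to its mirror image is either 0, for a vertex on the
  axis of symmetry, or the length of a single step across the axis. That step joins equal heights,
  so it is horizontal.\<close>

lemma half_paths_iff:
  assumes k: "k > 0"
  shows "us \<in> half_paths s k \<longleftrightarrow> dyck_prefix (2 * k) us
     \<and> (fst (last us) = real s / 2 \<or> (\<exists>l\<in>{1..<2 * k}. real s - 2 * fst (last us) = real l))"
proof (cases "dyck_prefix (2 * k) us")
  case True
  then obtain m h where "us \<in> prefixes_to k m h" using k by (rule dyck_prefix_last)
  hence m: "fst (last us) = of_int m" unfolding prefixes_to_def by simp
  have "us \<in> half_paths s k \<longleftrightarrow> (\<exists>i<k. m = int (s div 2) - int i)"
    using True m unfolding half_paths_def prefixes_to_abscissa_def by auto
  also have "\<dots> \<longleftrightarrow> m \<le> int (s div 2) \<and> int (s div 2) < m + int k"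
  proof
    assume "m \<le> int (s div 2) \<and> int (s div 2) < m + int k"
    thus "\<exists>i<k. m = int (s div 2) - int i"
      by (intro exI[of _ "nat (int (s div 2) - m)"]) auto
  qed auto
  \<comment> \<open>For either parity of \<open>s\<close>, \<open>m \<le> s div 2\<close> means
    \<open>2 * m \<le> s\<close>, and \<open>s div 2 < m + k\<close> means
    \<open>s < 2 * (m + k)\<close>.\<close>
  also have "\<dots> \<longleftrightarrow> 0 \<le> int s - 2 * m \<and> int s - 2 * m < 2 * int k"
    using k by presburger
  also have "\<dots> \<longleftrightarrow> 2 * m = int s \<or> (\<exists>l\<in>{1..<2 * k}. int s - 2 * m = int l)"
  proof
    assume "0 \<le> int s - 2 * m \<and> int s - 2 * m < 2 * int k"
    thus "2 * m = int s \<or> (\<exists>l\<in>{1..<2 * k}. int s - 2 * m = int l)"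
      by (cases "2 * m = int s") (auto intro!: bexI[of _ "nat (int s - 2 * m)"])
  qed (use k in auto)
  also have "2 * m = int s \<longleftrightarrow> fst (last us) = real s / 2"
    unfolding m by linarith
  also have "(\<exists>l\<in>{1..<2 * k}. int s - 2 * m = int l)
      \<longleftrightarrow> (\<exists>l\<in>{1..<2 * k}. real s - 2 * fst (last us) = real l)"
    unfolding m by (intro bex_cong refl) linarith
  finally show ?thesis using True by blast
qed (auto simp: half_paths_def prefixes_to_abscissa_def)

section \<open>Cutting symmetric paths in half and completing them\<close>

abbreviation reflect_point :: "nat \<Rightarrow> real \<times> real \<Rightarrow> real \<times> real" where
  "reflect_point s \<equiv> \<lambda>(x, y). (real s - x, y)"

lemma reflect_path_append: "reflect_path s (us @ vs) = reflect_path s vs @ reflect_path s us"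
  unfolding reflect_path_def by simp

lemma reflect_path_reflect_path [simp]: "reflect_path s (reflect_path s us) = us"
  unfolding reflect_path_def by (simp add: rev_map case_prod_beta o_def)

lemma length_reflect_path [simp]: "length (reflect_path s us) = length us"
  unfolding reflect_path_def by simp

lemma reflect_path_eq_Nil [simp]: "reflect_path s us = [] \<longleftrightarrow> us = []"
  unfolding reflect_path_def by simp

lemma reflect_path_Nil [simp]: "reflect_path s [] = []"
  unfolding reflect_path_def by simp

lemma hd_reflect_path: "us \<noteq> [] \<Longrightarrow> hd (reflect_path s us) = reflect_point s (last us)"
  unfolding reflect_path_def by (simp add: hd_rev last_map)

lemma last_reflect_path: "us \<noteq> [] \<Longrightarrow> last (reflect_path s us) = reflect_point s (hd us)"
  unfolding reflect_path_def by (simp add: last_rev hd_map)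

lemma dyck_steps_minus: "(dx, - dy) \<in> dyck_steps k \<longleftrightarrow> (dx, dy) \<in> dyck_steps k"
  unfolding dyck_steps_def by auto

text \<open>Mirroring with reversed direction of travel keeps the horizontal displacement and
  negates the vertical one, and the step set is closed under that sign change.\<close>

lemma dyck_edge_reflect:
  "dyck_edge k (reflect_point s v) (reflect_point s u) \<longleftrightarrow> dyck_edge k u v"
  using dyck_steps_minus[of "fst v - fst u" "snd v - snd u"] by (auto simp: case_prod_beta)

lemma successively_reflect_path:
  "successively (dyck_edge k) (reflect_path s us) \<longleftrightarrow> successively (dyck_edge k) us"
  unfolding reflect_path_def successively_rev successively_map dyck_edge_reflect ..

text \<open>The mirror image of the start \<open>(0, 0)\<close> is \<open>(real s, 0)\<close>, so
  symmetry supplies the end condition.\<close>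

lemma symmetric_dyck_path_iff:
  "symmetric_dyck_path s k vs \<longleftrightarrow> dyck_prefix k vs \<and> reflect_path s vs = vs"
proof -
  have "last vs = (real s, 0)" if "dyck_prefix k vs" "reflect_path s vs = vs"
    using last_reflect_path[of vs s] that unfolding dyck_prefix_def by simp
  thus ?thesis
    unfolding symmetric_dyck_path_def dyck_path_def dyck_prefix_def by blast
qed

text \<open>A last vertex on the axis of symmetry is its own mirror image; \<open>tl\<close>
  prevents it from occurring twice.\<close>

definition complete_path :: "nat \<Rightarrow> (real \<times> real) list \<Rightarrow> (real \<times> real) list" where
  "complete_path s us =
     us @ (if fst (last us) = real s / 2 then tl (reflect_path s us) else reflect_path s us)"

text \<open>Rounding up keeps the middle vertex when there is one.\<close>

definition left_half :: "'a list \<Rightarrow> 'a list" where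
  "left_half vs = take (Suc (length vs) div 2) vs"

lemma left_half_complete_path: "us \<noteq> [] \<Longrightarrow> left_half (complete_path s us) = us"
  unfolding left_half_def complete_path_def by (cases us) auto

lemma symmetric_complete_path:
  assumes k: "k > 0" and us: "us \<in> half_paths s k"
  shows "symmetric_dyck_path s (2 * k) (complete_path s us)"
proof -
  have pre: "dyck_prefix (2 * k) us" and ends: "fst (last us) = real s / 2 \<or>
      (\<exists>l\<in>{1..<2 * k}. real s - 2 * fst (last us) = real l)"
    using us half_paths_iff[OF k] by auto
  have us: "us \<noteq> []" "hd us = (0, 0)" "successively (dyck_edge (2 * k)) us"
    "\<And>x y. (x, y) \<in> set us \<Longrightarrow> 0 \<le> y"
    using pre unfolding dyck_prefix_def by auto
  have pos: "0 \<le> y" if "(x, y) \<in> set (reflect_path s us)" for x y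
    using that us(4) unfolding reflect_path_def by auto
  show ?thesis
  proof (cases "fst (last us) = real s / 2")
    case True
    define ws where "ws = butlast us"
    have ws: "us = ws @ [last us]" using us(1) unfolding ws_def by simp
    obtain y where y: "last us = (real s / 2, y)" using True by (cases "last us") auto
    have r: "reflect_path s us = last us # reflect_path s ws"
      by (subst ws, subst reflect_path_append) (simp add: reflect_path_def y)
    hence eq: "complete_path s us = us @ reflect_path s ws"
      using True unfolding complete_path_def by simp
    \<comment> \<open>The second way of cutting the path at its middle vertex; reflection
      interchanges the two.\<close>
    have eq': "complete_path s us = ws @ reflect_path s us"
      unfolding eq r by (subst ws) simp
    have "reflect_path s (complete_path s us) = complete_path s us"
      unfolding eq reflect_path_append using eq eq' by simp
    moreover have "successively (dyck_edge (2 * k)) (us @ reflect_path s ws)"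
    proof -
      have "successively (dyck_edge (2 * k)) (last us # reflect_path s ws)"
        unfolding r[symmetric] successively_reflect_path by (rule us(3))
      thus ?thesis
        using us(1,3) unfolding successively_append_iff successively_Cons by auto
    qed
    moreover have "set (complete_path s us) \<subseteq> set us \<union> set (reflect_path s us)"
      unfolding eq r by auto
    ultimately show ?thesis
      using us pos unfolding symmetric_dyck_path_iff dyck_prefix_def
      by (auto simp: eq)
  next
    case False
    then obtain l where l: "l \<in> {1..<2 * k}" "real s - 2 * fst (last us) = real l"
      using ends by blast
    have eq: "complete_path s us = us @ reflect_path s us"
      using False unfolding complete_path_def by simp
    have "dyck_edge (2 * k) (last us) (hd (reflect_path s us))"
      unfolding hd_reflect_path[OF us(1)] using l
      by (auto simp: dyck_steps_even_iff case_prod_beta)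
    thus ?thesis
      using us pos unfolding symmetric_dyck_path_iff dyck_prefix_def eq reflect_path_append
      by (auto simp: successively_append_iff successively_reflect_path)
  qed
qed

lemma dyck_prefix_take:
  assumes "dyck_prefix k vs" "n > 0"
  shows "dyck_prefix k (take n vs)"
proof -
  have "successively (dyck_edge k) (take n vs @ drop n vs)"
    using assms(1) unfolding dyck_prefix_def by simp
  hence "successively (dyck_edge k) (take n vs)"
    unfolding successively_append_iff by blast
  thus ?thesis
    using assms unfolding dyck_prefix_def by (auto dest: in_set_takeD)
qed

text \<open>The parity of the number of vertices decides: if it is even, a step crosses the axis of
  symmetry; if it is odd, the middle vertex lies on it.\<close>

lemma complete_path_left_half:
  assumes k: "k > 0" and sym: "symmetric_dyck_path s (2 * k) vs"
  shows "left_half vs \<in> half_paths s k" "complete_path s (left_half vs) = vs"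
proof -
  have pre: "dyck_prefix (2 * k) vs" and refl: "reflect_path s vs = vs"
    using sym unfolding symmetric_dyck_path_iff by auto
  have ne: "vs \<noteq> []" and succ: "successively (dyck_edge (2 * k)) vs"
    using pre unfolding dyck_prefix_def by auto
  define n where "n = Suc (length vs) div 2"
  define us where "us = left_half vs"
  have us: "us = take n vs" unfolding us_def left_half_def n_def by simp
  have n: "n > 0" "n \<le> length vs" using ne unfolding n_def by (cases vs; simp)+
  hence us_ne: "us \<noteq> []" using ne us by simp
  have drop: "drop m vs = reflect_path s (take (length vs - m) vs)" if "m \<le> length vs" for m
  proof -
    have "drop m vs = drop m (reflect_path s vs)" using refl by simp
    thus ?thesis using that unfolding reflect_path_def by (simp add: drop_rev take_map)
  qed
  have pre': "dyck_prefix (2 * k) us" unfolding us using pre n(1) by (rule dyck_prefix_take)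
  have split: "vs = us @ drop n vs" unfolding us by simp
  have "us \<in> half_paths s k \<and> complete_path s us = vs"
  proof (cases "even (length vs)")
    case True
    hence "length vs - n = n" unfolding n_def by auto
    hence d: "drop n vs = reflect_path s us" using drop[OF n(2)] us by simp
    have "dyck_edge (2 * k) (last us) (hd (reflect_path s us))"
      using succ us_ne by (subst (asm) split) (auto simp: successively_append_iff d)
    \<comment> \<open>Both ends of the middle step have the same height, so only a horizontal step
      is possible.\<close>
    hence "(real s - 2 * fst (last us), 0) \<in> dyck_steps (2 * k)"
      unfolding hd_reflect_path[OF us_ne] by (simp add: case_prod_beta algebra_simps)
    then obtain l where l: "l \<in> {1..<2 * k}" "real s - 2 * fst (last us) = real l"
      unfolding dyck_steps_even_iff by auto
    hence "fst (last us) \<noteq> real s / 2" by auto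
    hence "complete_path s us = vs"
      using split d unfolding complete_path_def by simp
    thus ?thesis using half_paths_iff[OF k] pre' l by blast
  next
    case False
    \<comment> \<open>\<open>us\<close> and its mirror image overlap in the middle vertex, so the
      right half begins at index \<open>n - 1\<close>.\<close>
    hence len: "length vs - (n - 1) = n" "n - 1 \<le> length vs" unfolding n_def by presburger+
    hence d: "drop (n - 1) vs = reflect_path s us" using drop[of "n - 1"] us by simp
    have "drop n vs = tl (drop (n - 1) vs)" using n(1) by (cases n) (simp_all add: drop_Suc tl_drop)
    hence d': "drop n vs = tl (reflect_path s us)" using d by simp
    have "last us = vs ! (n - 1)"
      using us n us_ne by (simp add: last_conv_nth)
    also have "\<dots> = hd (drop (n - 1) vs)"
      using n by (simp add: hd_drop_conv_nth)
    also have "\<dots> = reflect_point s (last us)"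
      unfolding d hd_reflect_path[OF us_ne] ..
    finally have "fst (last us) = real s / 2" by (cases "last us") auto
    hence "complete_path s us = vs" "fst (last us) = real s / 2"
      using split d' unfolding complete_path_def by auto
    thus ?thesis using half_paths_iff[OF k] pre' by blast
  qed
  thus "left_half vs \<in> half_paths s k" "complete_path s (left_half vs) = vs"
    unfolding us_def by auto
qed

lemma card_symmetric_dyck_paths:
  assumes k: "k > 0"
  shows "card {vs. symmetric_dyck_path s (2 * k) vs} = card (half_paths s k)"
proof -
  have ne: "us \<noteq> []" if "us \<in> half_paths s k" for us
    using that half_paths_iff[OF k] unfolding dyck_prefix_def by blast
  have "bij_betw (complete_path s) (half_paths s k) {vs. symmetric_dyck_path s (2 * k) vs}"
  proof (rule bij_betw_byWitness[where f' = left_half])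
    show "\<forall>us\<in>half_paths s k. left_half (complete_path s us) = us"
      using ne left_half_complete_path by blast
    show "complete_path s ` half_paths s k \<subseteq> {vs. symmetric_dyck_path s (2 * k) vs}"
      using symmetric_complete_path[OF k] by blast
  qed (use complete_path_left_half[OF k] in blast)+
  thus ?thesis by (simp add: bij_betw_same_card)
qed

section \<open>Beads of a partition\<close>

definition part :: "nat list \<Rightarrow> nat \<Rightarrow> nat" where
  "part p i = (if i < length p then p ! i else 0)"

text \<open>Column lengths, that is, the parts of the conjugate partition.\<close>

definition leg :: "nat list \<Rightarrow> nat \<Rightarrow> nat" where
  "leg p j = card {i. j < part p i}"

definition bead :: "nat list \<Rightarrow> nat \<Rightarrow> int" where
  "bead p i = int (part p i) - int i - 1"

definition gap :: "nat list \<Rightarrow> nat \<Rightarrow> int" where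
  "gap p j = int j - int (leg p j)"

text \<open>The Maya diagram of charge 0. As the parts are padded by zeros, it contains all
  sufficiently negative integers.\<close>

definition maya :: "nat list \<Rightarrow> int set" where
  "maya p = range (bead p)"

lemma part_eq_0: "length p \<le> i \<Longrightarrow> part p i = 0"
  by (simp add: part_def)

lemma young_diagram_iff: "(i, j) \<in> young_diagram p \<longleftrightarrow> j < part p i"
  by (auto simp: young_diagram_def part_def)

lemma part_antimono:
  assumes "is_partition p" "i \<le> i'"
  shows "part p i' \<le> part p i"
proof (cases "i < i' \<and> i' < length p")
  case True
  thus ?thesis using assms(1) unfolding is_partition_def part_def
    by (auto simp: sorted_wrt_iff_nth_less)
next
  case False
  thus ?thesis using assms(2) by (cases "i = i'") (auto simp: part_def)
qed

text \<open>Parts decrease, so the rows meeting column \<open>j\<close> form an initial segment,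
  whose size is the column length.\<close>

lemma less_part_iff:
  assumes p: "is_partition p"
  shows "j < part p i \<longleftrightarrow> i < leg p j"
proof -
  let ?A = "{i. j < part p i}"
  have "?A \<subseteq> {..<length p}" by (auto simp: part_def)
  hence fin: "finite ?A" by (rule finite_subset) simp
  have down: "i' \<in> ?A" if "i \<in> ?A" "i' \<le> i" for i i'
    using that part_antimono[OF p, of i' i] by simp
  have "?A = {..<leg p j}"
  proof (rule card_subset_eq[symmetric])
    show "{..<leg p j} \<subseteq> ?A"
    proof
      fix i assume "i \<in> {..<leg p j}"
      hence i: "i < card ?A" unfolding leg_def by simp
      show "i \<in> ?A"
      proof (rule ccontr)
        assume "i \<notin> ?A"
        hence "?A \<subseteq> {..<i}" using down by (meson lessThan_iff not_le subsetI)
        from card_mono[OF _ this] i show False by simp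
      qed
    qed
  qed (simp_all add: fin leg_def)
  thus ?thesis by (metis lessThan_iff mem_Collect_eq)
qed

lemma leg_antimono:
  assumes "is_partition p" "j \<le> j'"
  shows "leg p j' \<le> leg p j"
proof (rule ccontr)
  assume "\<not> leg p j' \<le> leg p j"
  hence "j' < part p (leg p j)" using less_part_iff[OF assms(1)] by simp
  hence "j < part p (leg p j)" using assms(2) by simp
  thus False using less_part_iff[OF assms(1)] by simp
qed

text \<open>The box is counted with its row only, so the hook length is
  \<open>(part p i - j) + (leg p j - i - 1)\<close>.\<close>

lemma hook_length_eq:
  assumes p: "is_partition p" and box: "j < part p i"
  shows "int (hook_length p (i, j)) = bead p i - gap p j"
proof -
  have "{j'. j \<le> j' \<and> (i, j') \<in> young_diagram p} = {j..<part p i}"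
    by (auto simp: young_diagram_iff)
  moreover have "{i'. i < i' \<and> (i', j) \<in> young_diagram p} = {i<..<leg p j}"
    by (auto simp: young_diagram_iff less_part_iff[OF p])
  ultimately show ?thesis
    using box less_part_iff[OF p, of j i] unfolding hook_length_def bead_def gap_def by auto
qed

text \<open>The difference \<open>bead p i - gap p j\<close> is
  \<open>(part p i - j) + (leg p j - i) - 1\<close>. Both brackets are positive for a box and both
  are at most 0 otherwise, so it is never 0.\<close>

lemma gap_less_bead_iff:
  assumes "is_partition p"
  shows "gap p j < bead p i \<longleftrightarrow> j < part p i"
  using less_part_iff[OF assms, of j i] unfolding gap_def bead_def by auto

lemma gap_neq_bead:
  assumes "is_partition p"
  shows "gap p j \<noteq> bead p i"
  using less_part_iff[OF assms, of j i] unfolding gap_def bead_def by auto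

text \<open>Let \<open>i\<close> be the first index with \<open>bead p i \<le> z\<close> for a
  non-bead \<open>z\<close>. Then column \<open>j = z + i\<close> has length exactly
  \<open>i\<close>, so its gap is \<open>z\<close>.\<close>

lemma range_gap:
  assumes p: "is_partition p"
  shows "range (gap p) = - maya p"
proof (intro equalityI subsetI)
  fix z assume "z \<in> - maya p"
  hence z: "bead p i \<noteq> z" for i unfolding maya_def by auto
  define i where "i = (LEAST i. bead p i \<le> z)"
  have "bead p (length p + nat (- z)) \<le> z"
    unfolding bead_def by (simp add: part_eq_0)
  hence i: "bead p i \<le> z" unfolding i_def by (rule LeastI)
  hence lt: "bead p i < z" using z[of i] by simp
  hence "0 \<le> z + int i" unfolding bead_def by linarith
  then obtain j where j: "z + int i = int j" by (rule nonneg_int_cases)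
  have "part p i \<le> j" using lt j unfolding bead_def by linarith
  hence "leg p j \<le> i" using less_part_iff[OF p, of j i] by simp
  moreover have "i \<le> leg p j"
  proof (cases i)
    case (Suc i')
    hence "\<not> bead p i' \<le> z" using not_less_Least[of i' "\<lambda>i. bead p i \<le> z"] unfolding i_def by simp
    hence "j < part p i'" using j Suc unfolding bead_def by simp
    thus ?thesis using less_part_iff[OF p] Suc by simp
  qed simp
  ultimately have "gap p j = z" using j unfolding gap_def by simp
  thus "z \<in> range (gap p)" by blast
qed (use gap_neq_bead[OF p] in \<open>auto simp: maya_def\<close>)

text \<open>If \<open>z\<close> is a bead and \<open>z - t\<close> is not, the latter is a gap and
  yields a box of hook length \<open>t\<close>. Conversely, a hook length \<open>t * m\<close> would
  lead by \<open>m\<close> subtractions of \<open>t\<close> from a bead to a gap.\<close>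

lemma core_iff_maya:
  assumes p: "is_partition p" and t: "t > 0"
  shows "core t p \<longleftrightarrow> (\<forall>z\<in>maya p. z - int t \<in> maya p)"
proof
  assume c: "core t p"
  show "\<forall>z\<in>maya p. z - int t \<in> maya p"
  proof (intro ballI, rule ccontr)
    fix z assume "z \<in> maya p" and n: "z - int t \<notin> maya p"
    then obtain i where i: "z = bead p i" unfolding maya_def by blast
    from n have "z - int t \<in> range (gap p)" unfolding range_gap[OF p] by simp
    then obtain j where j: "z - int t = gap p j" by blast
    have box: "j < part p i" using i j t gap_less_bead_iff[OF p, of j i] by simp
    hence "int (hook_length p (i, j)) = int t" using hook_length_eq[OF p] i j by simp
    thus False using c box unfolding core_def young_diagram_iff[symmetric] by fastforce
  qed
next
  assume closed: "\<forall>z\<in>maya p. z - int t \<in> maya p"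
  have iter: "z - int t * int m \<in> maya p" if "z \<in> maya p" for z m
  proof (induction m)
    case (Suc m)
    have "z - int t * int m - int t \<in> maya p" using closed Suc by blast
    thus ?case by (simp add: algebra_simps)
  qed (use that in simp)
  show "core t p" unfolding core_def
  proof (intro ballI notI)
    fix b assume b: "b \<in> young_diagram p" and dvd: "t dvd hook_length p b"
    obtain i j where ij: "b = (i, j)" by (cases b)
    hence box: "j < part p i" using b young_diagram_iff by simp
    from dvd obtain m where "hook_length p b = t * m" by blast
    hence "bead p i - int t * int m = gap p j"
      using hook_length_eq[OF p box] ij by simp
    moreover have "bead p i - int t * int m \<in> maya p"
      by (rule iter) (simp add: maya_def)
    moreover have "gap p j \<notin> maya p"
      using range_gap[OF p] by blast
    ultimately show False by simp
  qed
qed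

section \<open>Self-conjugacy in terms of beads, and recovering a partition from its beads\<close>

lemma strict_mono_range_unique:
  fixes f g :: "nat \<Rightarrow> int"
  assumes f: "strict_mono f" and g: "strict_mono g" and eq: "range f = range g"
  shows "f = g"
proof
  fix n show "f n = g n"
  proof (induction n rule: less_induct)
    case (less n)
    have "u n \<le> v n" if u: "strict_mono u" and v: "strict_mono v" and "range u = range v"
      and IH: "\<And>i. i < n \<Longrightarrow> u i = v i" for u v :: "nat \<Rightarrow> int"
    proof -
      obtain m where m: "v n = u m" using \<open>range u = range v\<close> by (metis rangeE rangeI)
      have "\<not> m < n" using IH[of m] m strict_mono_less[OF v, of m n] by auto
      thus ?thesis using m strict_mono_less_eq[OF u, of n m] by simp
    qed
    from this[of f g] this[of g f] show ?case using assms less by force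
  qed
qed

lemma strict_mono_minus_bead:
  assumes "is_partition p"
  shows "strict_mono (\<lambda>i. - 1 - bead p i)"
  unfolding strict_mono_Suc_iff bead_def
proof
  fix n show "- 1 - (int (part p n) - int n - 1) < - 1 - (int (part p (Suc n)) - int (Suc n) - 1)"
    using part_antimono[OF assms, of n "Suc n"] by simp
qed

lemma strict_mono_gap:
  assumes "is_partition p"
  shows "strict_mono (gap p)"
  unfolding strict_mono_Suc_iff gap_def
proof
  fix n show "int n - int (leg p n) < int (Suc n) - int (leg p (Suc n))"
    using leg_antimono[OF assms, of n "Suc n"] by simp
qed

lemma self_conjugate_iff_leg:
  assumes p: "is_partition p"
  shows "self_conjugate p \<longleftrightarrow> part p = leg p"
proof -
  have "(i, j) \<in> conjugate_diagram (young_diagram p) \<longleftrightarrow> j < leg p i" for i j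
    unfolding conjugate_diagram_def
    by (simp add: image_iff young_diagram_iff Bex_def less_part_iff[OF p] split_paired_Ex)
  hence "self_conjugate p \<longleftrightarrow> (\<forall>i j. j < leg p i \<longleftrightarrow> j < part p i)"
    unfolding self_conjugate_def set_eq_iff by (simp add: young_diagram_iff split_paired_All)
  also have "\<dots> \<longleftrightarrow> part p = leg p"
    unfolding fun_eq_iff by (metis less_irrefl not_less_iff_gr_or_eq)
  finally show ?thesis .
qed

text \<open>The reflected beads \<open>- 1 - bead p i\<close> are \<open>i - part p i\<close>, which
  are gaps with rows in place of columns. Both sequences increase strictly, so they agree iff their
  ranges do.\<close>

lemma self_conjugate_iff_maya:
  assumes p: "is_partition p"
  shows "self_conjugate p \<longleftrightarrow> (\<forall>z. z \<in> maya p \<longleftrightarrow> - 1 - z \<notin> maya p)"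
proof -
  have refl: "- 1 - bead p i = int i - int (part p i)" for i
    unfolding bead_def by simp
  have "self_conjugate p \<longleftrightarrow> (\<lambda>i. - 1 - bead p i) = gap p"
    unfolding self_conjugate_iff_leg[OF p] refl gap_def fun_eq_iff by simp
  also have "\<dots> \<longleftrightarrow> range (\<lambda>i. - 1 - bead p i) = range (gap p)"
    by (rule iffI[OF arg_cong[where f = range]
          strict_mono_range_unique[OF strict_mono_minus_bead[OF p] strict_mono_gap[OF p]]])
  also have "range (\<lambda>i. - 1 - bead p i) = {z. - 1 - z \<in> maya p}"
  proof (intro equalityI subsetI)
    fix z assume "z \<in> {z. - 1 - z \<in> maya p}"
    then obtain i where "- 1 - z = bead p i" unfolding maya_def by blast
    hence "z = - 1 - bead p i" by simp
    thus "z \<in> range (\<lambda>i. - 1 - bead p i)" by blast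
  qed (auto simp: maya_def)
  also have "{z. - 1 - z \<in> maya p} = range (gap p) \<longleftrightarrow> (\<forall>z. z \<in> maya p \<longleftrightarrow> - 1 - z \<notin> maya p)"
    unfolding range_gap[OF p] set_eq_iff by auto
  finally show ?thesis .
qed

lemma maya_inj:
  assumes p: "is_partition p" and q: "is_partition q" and eq: "maya p = maya q"
  shows "p = q"
proof -
  have "range (\<lambda>i. - 1 - bead p i) = range (\<lambda>i. - 1 - bead q i)"
    using eq unfolding maya_def by (metis image_image)
  hence "(\<lambda>i. - 1 - bead p i) = (\<lambda>i. - 1 - bead q i)"
    by (rule strict_mono_range_unique[OF strict_mono_minus_bead[OF p] strict_mono_minus_bead[OF q]])
  hence part: "part p i = part q i" for i
    unfolding bead_def fun_eq_iff by simp
  have pos: "part r i > 0 \<longleftrightarrow> i < length r" if "is_partition r" for r i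
    using that nth_mem[of i r] unfolding is_partition_def part_def by (metis not_gr0)
  have "i < length p \<longleftrightarrow> i < length q" for i
    using pos[OF p, of i] pos[OF q, of i] part[of i] by simp
  hence len: "length p = length q" by (metis less_irrefl not_less_iff_gr_or_eq)
  show ?thesis
  proof (rule nth_equalityI[OF len])
    fix i assume "i < length p"
    thus "p ! i = q ! i" using part[of i] len by (simp add: part_def)
  qed
qed

lemma part_of_antimono:
  fixes f :: "nat \<Rightarrow> nat"
  assumes anti: "\<And>i j. i \<le> j \<Longrightarrow> f j \<le> f i" and fn: "f n = 0"
  obtains p where "is_partition p" "part p = f"
proof -
  define m where "m = (LEAST i. f i = 0)"
  have fm: "f m = 0" unfolding m_def using fn by (rule LeastI)
  have pos: "f i > 0" if "i < m" for i
    using not_less_Least[of i "\<lambda>i. f i = 0"] that unfolding m_def by simp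
  define p where "p = map f [0..<m]"
  have "0 \<notin> set p"
    unfolding p_def using pos by fastforce
  hence "is_partition p"
    unfolding is_partition_def p_def by (simp add: sorted_wrt_iff_nth_less anti)
  moreover have "part p i = f i" for i
    using anti[of m i] fm unfolding part_def p_def by auto
  ultimately show thesis using that by blast
qed

text \<open>Antisymmetry forces the charge of the diagram to be zero: exactly one of \<open>x\<close> and \<open>- 1 - x\<close>
  is a bead, so there are \<open>n\<close> beads in \<open>{- n..<n}\<close>.\<close>

lemma maya_surj:
  assumes bound: "\<And>z. z \<in> S \<Longrightarrow> z < int n" and anti: "\<And>z. z \<in> S \<longleftrightarrow> - 1 - z \<notin> S"
  obtains p where "is_partition p" "maya p = S"
proof -
  have low: "z \<in> S" if "z < - int n" for z
    using anti[of z] bound[of "- 1 - z"] that by auto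
  define T where "T = S \<inter> {- int n..<int n}"
  have fin: "finite T" unfolding T_def by simp
  have "card T = n"
  proof -
    let ?R = "\<lambda>z. - 1 - z :: int"
    have "T \<union> ?R ` T = {- int n..<int n}"
    proof (intro equalityI subsetI)
      fix z assume z: "z \<in> {- int n..<int n}"
      show "z \<in> T \<union> ?R ` T"
      proof (cases "z \<in> S")
        case False
        hence "?R z \<in> T" using anti[of z] z unfolding T_def by auto
        moreover have "z = ?R (?R z)" by simp
        ultimately show ?thesis by blast
      qed (use z in \<open>auto simp: T_def\<close>)
    qed (auto simp: T_def)
    moreover have "T \<inter> ?R ` T = {}"
    proof (intro disjoint_iff[THEN iffD2] allI impI notI)
      fix z assume "z \<in> T" "z \<in> ?R ` T"
      hence "z \<in> S" "- 1 - z \<in> S" unfolding T_def by auto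
      thus False using anti[of z] by blast
    qed
    moreover have "card (?R ` T) = card T"
      by (rule card_image) (auto simp: inj_on_def)
    ultimately have "2 * card T = card {- int n..<int n}"
      using card_Un_disjoint[of T "?R ` T"] fin by simp
    thus ?thesis by simp
  qed
  define xs where "xs = rev (sorted_list_of_set T)"
  have len: "length xs = n" using \<open>card T = n\<close> unfolding xs_def by simp
  have set: "set xs = T" using fin unfolding xs_def by simp
  have "sorted_wrt (>) xs" unfolding xs_def sorted_wrt_rev by simp
  hence dec: "xs ! j < xs ! i" if "i < j" "j < n" for i j
    using len that by (simp add: sorted_wrt_iff_nth_less)
  define f where "f = (\<lambda>i. if i < n then nat (xs ! i + int i + 1) else 0)"
  have nonneg: "xs ! i + int i + 1 \<ge> 0" if "i < n" for i
  proof -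
    \<comment> \<open>Entry \<open>i\<close> is followed by \<open>n - 1 - i\<close> smaller
      entries, all at least \<open>- n\<close>.\<close>
    have "xs ! i \<ge> - int n + int (n - 1 - i)" using that
    proof (induction "n - 1 - i" arbitrary: i)
      case 0
      have "xs ! i \<in> T" using set len 0 nth_mem by metis
      thus ?case using 0 unfolding T_def by auto
    next
      case (Suc d)
      have i: "Suc i < n" "d = n - 1 - Suc i" using Suc(2) by auto
      show ?case using Suc(1)[OF i(2,1)] dec[of i "Suc i"] i by simp
    qed
    thus ?thesis using that by linarith
  qed
  have step: "f (Suc i) \<le> f i" for i
    using dec[of i "Suc i"] unfolding f_def by auto
  have "f j \<le> f i" if "i \<le> j" for i j
    using lift_Suc_antimono_le[of f, OF step that] .
  then obtain p where p: "is_partition p" "part p = f"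
    by (rule part_of_antimono[of f n]) (simp_all add: f_def)
  have bead: "bead p i = (if i < n then xs ! i else - int i - 1)" for i
    using nonneg[of i] unfolding bead_def p(2) f_def by simp
  have "maya p = S"
  proof (intro equalityI subsetI)
    fix z assume "z \<in> maya p"
    then obtain i where i: "z = bead p i" unfolding maya_def by blast
    show "z \<in> S"
    proof (cases "i < n")
      case True
      hence "z \<in> T" using set len i bead by (metis nth_mem)
      thus ?thesis unfolding T_def by simp
    qed (use i bead low in simp)
  next
    fix z assume z: "z \<in> S"
    show "z \<in> maya p"
    proof (cases "z < - int n")
      case True
      hence "bead p (nat (- z - 1)) = z" unfolding bead by auto
      thus ?thesis unfolding maya_def by (metis rangeI)
    next
      case False
      hence "z \<in> set xs" using z bound unfolding set T_def by auto
      then obtain i where "i < n" "xs ! i = z" using len by (metis in_set_conv_nth)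
      hence "bead p i = z" unfolding bead by simp
      thus ?thesis unfolding maya_def by (metis rangeI)
    qed
  qed
  thus thesis using p that by blast
qed

text \<open>The bead sets of the cores to be counted. Antisymmetry turns the upper bound into the
  presence of all sufficiently negative integers.\<close>

definition core_mayas :: "nat \<Rightarrow> nat \<Rightarrow> int set set" where
  "core_mayas s k = {S. (\<exists>n. \<forall>z\<in>S. z < int n) \<and> (\<forall>z. z \<in> S \<longleftrightarrow> - 1 - z \<notin> S)
     \<and> (\<forall>t\<in>{s..s + 2 * k}. \<forall>z\<in>S. z - int t \<in> S)}"

lemma card_self_conjugate_cores:
  assumes "s > 0"
  shows "card {p. is_partition p \<and> self_conjugate p \<and> simultaneous_core {s..s + 2 * k} p}
    = card (core_mayas s k)"
proof -
  let ?P = "{p. is_partition p \<and> self_conjugate p \<and> simultaneous_core {s..s + 2 * k} p}"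
  have closed: "simultaneous_core {s..s + 2 * k} p
      \<longleftrightarrow> (\<forall>t\<in>{s..s + 2 * k}. \<forall>z\<in>maya p. z - int t \<in> maya p)" if "is_partition p" for p
    unfolding simultaneous_core_def using core_iff_maya[OF that] assms
    by (intro ball_cong refl) auto
  have "bij_betw maya ?P (core_mayas s k)"
  proof (rule bij_betw_imageI)
    show "inj_on maya ?P" by (rule inj_onI) (auto intro: maya_inj)
    show "maya ` ?P = core_mayas s k"
    proof (intro equalityI subsetI)
      fix S assume "S \<in> maya ` ?P"
      then obtain p where p: "S = maya p" "is_partition p" "self_conjugate p"
        "simultaneous_core {s..s + 2 * k} p" by blast
      have "bead p i < int (part p 0)" for i
        using part_antimono[OF p(2), of 0 i] unfolding bead_def by simp
      hence "\<forall>z\<in>S. z < int (part p 0)" unfolding p(1) maya_def by blast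
      thus "S \<in> core_mayas s k"
        unfolding core_mayas_def
        using p(3,4) self_conjugate_iff_maya[OF p(2)] closed[OF p(2)] p(1) by blast
    next
      fix S assume S: "S \<in> core_mayas s k"
      then obtain n where "\<And>z. z \<in> S \<Longrightarrow> z < int n" "\<And>z. z \<in> S \<longleftrightarrow> - 1 - z \<notin> S"
        unfolding core_mayas_def by blast
      then obtain p where p: "is_partition p" "maya p = S" by (rule maya_surj)
      thus "S \<in> maya ` ?P"
        using S self_conjugate_iff_maya[OF p(1)] closed[OF p(1)]
        unfolding core_mayas_def by blast
    qed
  qed
  thus ?thesis by (rule bij_betw_same_card)
qed

section \<open>Levels of a core\<close>

definition antiext :: "(nat \<Rightarrow> int) \<Rightarrow> int \<Rightarrow> int" where
  "antiext h r = (if 0 \<le> r then h (nat r) else 1 - h (nat (- 1 - r)))"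

text \<open>The function \<open>H\<close> of the overview, rebuilt from \<open>h\<close>:
  \<open>c\<close> is written as \<open>r + m * N\<close> with
  \<open>s div 2 - N \<le> r < s div 2\<close>, and each period lowers the value by 1.\<close>

definition level :: "nat \<Rightarrow> nat \<Rightarrow> (nat \<Rightarrow> int) \<Rightarrow> int \<Rightarrow> int" where
  "level s k h c = (let N = int (s + k); L = N - int (s div 2)
     in antiext h ((c + L) mod N - L) - (c + L) div N)"

lemma antiext_minus: "antiext h (- 1 - r) = 1 - antiext h r"
  unfolding antiext_def by auto

lemma coarse_close:
  assumes "h \<in> coarse k M" "\<bar>int i - int j\<bar> \<le> int k"
  shows "\<bar>h i - h j\<bar> \<le> 1"
proof (cases "i \<le> j")
  case True
  moreover have "j \<le> i + k" using assms(2) by linarith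
  ultimately show ?thesis using assms(1) unfolding coarse_def by blast
next
  case False
  hence "j \<le> i" "i \<le> j + k" using assms(2) by linarith+
  hence "\<bar>h j - h i\<bar> \<le> 1" using assms(1) unfolding coarse_def by blast
  thus ?thesis by linarith
qed

text \<open>Only arguments \<open>x \<ge> 0 > y\<close> of opposite signs need more than coarseness
  of \<open>h\<close>. Then \<open>x\<close> and \<open>- 1 - y\<close> are below \<open>k\<close>,
  so both values lie in \<open>{0, 1}\<close>.\<close>

lemma antiext_close:
  assumes h: "h \<in> coarse01 k M" and d: "\<bar>r - r'\<bar> \<le> int k"
  shows "\<bar>antiext h r - antiext h r'\<bar> \<le> 1"
proof -
  have hC: "h \<in> coarse k M" and h01: "\<And>i. i < k \<Longrightarrow> h i = 0 \<or> h i = 1"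
    using h unfolding coarse01_def by auto
  have mixed: "\<bar>antiext h x - antiext h y\<bar> \<le> 1" if "0 \<le> x" "y < 0" "\<bar>x - y\<bar> \<le> int k" for x y
  proof -
    have "nat x < k" "nat (- 1 - y) < k" using that by linarith+
    thus ?thesis using h01[of "nat x"] h01[of "nat (- 1 - y)"] that unfolding antiext_def by auto
  qed
  consider "0 \<le> r" "0 \<le> r'" | "r < 0" "r' < 0" | "0 \<le> r" "r' < 0" | "r < 0" "0 \<le> r'"
    by linarith
  thus ?thesis
  proof cases
    case 1
    thus ?thesis using coarse_close[OF hC, of "nat r" "nat r'"] d unfolding antiext_def by simp
  next
    case 2
    thus ?thesis using coarse_close[OF hC, of "nat (- 1 - r')" "nat (- 1 - r)"] d
      unfolding antiext_def by simp
  next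
    case 3
    thus ?thesis using mixed d by blast
  next
    case 4
    thus ?thesis using mixed[of r' r] d by linarith
  qed
qed

lemma antiext_right: "h \<in> coarse k M \<Longrightarrow> int M \<le> r \<Longrightarrow> antiext h r = 0"
  unfolding antiext_def coarse_def by auto

lemma antiext_left: "h \<in> coarse k M \<Longrightarrow> r < - int M \<Longrightarrow> antiext h r = 1"
  using antiext_right[of h k M "- 1 - r"] antiext_minus[of h r] by simp

lemma period_split:
  fixes c :: int
  assumes "s > 0"
  obtains r m where "c = r + m * int (s + k)"
    "int (s div 2) - int (s + k) \<le> r" "r < int (s div 2)"
proof -
  let ?N = "int (s + k)" and ?L = "int (s + k) - int (s div 2)"
  have "?N > 0" using assms by simp
  hence "0 \<le> (c + ?L) mod ?N" "(c + ?L) mod ?N < ?N" by simp_all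
  moreover have "c = ((c + ?L) mod ?N - ?L) + ((c + ?L) div ?N) * ?N"
    using mod_div_mult_eq[of "c + ?L" ?N] by linarith
  ultimately show thesis
    by (intro that[of "(c + ?L) mod ?N - ?L" "(c + ?L) div ?N"]) auto
qed

text \<open>The two formulas that apply on an overlap of neighbouring windows agree, because the
  overlap lies in a range where \<open>h\<close> vanishes.\<close>

lemma level_eq:
  assumes s: "s > 0" and h: "h \<in> coarse k (s div 2)"
    and r: "int (s div 2) - int (s + k) \<le> r" "r < int (s + k) - int (s div 2)"
  shows "level s k h (r + m * int (s + k)) = antiext h r - m"
proof -
  let ?N = "int (s + k)" and ?L = "int (s + k) - int (s div 2)"
  have N: "?N > 0" using s by simp
  have *: "level s k h (r + m * ?N) = antiext h r - m" if "?L + r \<ge> 0" "?L + r < ?N" for r m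
  proof -
    have "(r + m * ?N + ?L) div ?N = m" "(r + m * ?N + ?L) mod ?N = r + ?L"
    proof -
      have eq: "r + m * ?N + ?L = (r + ?L) + m * ?N" by simp
      show "(r + m * ?N + ?L) div ?N = m"
        unfolding eq using that N by (subst div_mult_self1) auto
      show "(r + m * ?N + ?L) mod ?N = r + ?L"
        unfolding eq using that N by (subst mod_mult_self1) auto
    qed
    thus ?thesis unfolding level_def Let_def by simp
  qed
  show ?thesis
  proof (cases "r < int (s div 2)")
    case True
    thus ?thesis using *[of r m] r by simp
  next
    case False
    \<comment> \<open>Here \<open>r\<close> is represented in the basic window by
      \<open>r - N\<close>. The continuation is 1 there and 0 at \<open>r\<close>, which balances
      the change of \<open>m\<close>.\<close>
    have "level s k h (r + m * ?N) = level s k h ((r - ?N) + (m + 1) * ?N)"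
      by (simp add: algebra_simps)
    also have "\<dots> = antiext h (r - ?N) - (m + 1)"
      using r False by (intro *) auto
    also have "antiext h (r - ?N) = 1"
      using r(2) by (intro antiext_left[OF h]) linarith
    also have "1 - (m + 1) = antiext h r - m"
      using antiext_right[OF h, of r] False by simp
    finally show ?thesis .
  qed
qed

lemma level_shift:
  assumes s: "s > 0" and h: "h \<in> coarse k (s div 2)"
  shows "level s k h (c + j * int (s + k)) = level s k h c - j"
proof -
  obtain r m where rm: "c = r + m * int (s + k)"
    "int (s div 2) - int (s + k) \<le> r" "r < int (s div 2)"
    using period_split[OF s] by blast
  have eq: "c + j * int (s + k) = r + (m + j) * int (s + k)"
    unfolding rm(1) by (simp add: algebra_simps)
  have r: "r < int (s + k) - int (s div 2)" using rm(3) by linarith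
  have "level s k h c = antiext h r - m"
    unfolding rm(1) by (rule level_eq[OF s h rm(2) r])
  thus ?thesis
    unfolding eq level_eq[OF s h rm(2) r] by simp
qed

text \<open>For \<open>r\<close> in the basic window, \<open>- 1 - r\<close> lies in the larger
  range covered by \<open>level_eq\<close>, because
  \<open>s + k \<ge> 2 * (s div 2)\<close>.\<close>

lemma level_minus:
  assumes s: "s > 0" and h: "h \<in> coarse k (s div 2)"
  shows "level s k h (- 1 - c) = 1 - level s k h c"
proof -
  obtain r m where rm: "c = r + m * int (s + k)"
    "int (s div 2) - int (s + k) \<le> r" "r < int (s div 2)"
    using period_split[OF s] by blast
  have r: "r < int (s + k) - int (s div 2)" using rm(3) by linarith
  have eq: "- 1 - c = (- 1 - r) + (- m) * int (s + k)"
    unfolding rm(1) by (simp add: algebra_simps)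
  have "level s k h c = antiext h r - m"
    unfolding rm(1) by (rule level_eq[OF s h rm(2) r])
  moreover have "level s k h ((- 1 - r) + (- m) * int (s + k)) = antiext h (- 1 - r) - (- m)"
    using rm(2) r by (intro level_eq[OF s h]) linarith+
  ultimately show ?thesis
    unfolding eq antiext_minus by simp
qed

text \<open>If \<open>r < s div 2\<close>, then \<open>r + k < s + k - s div 2\<close>, so
  \<open>level_eq\<close> applies to both points with the same \<open>m\<close> and reduces the
  claim to \<open>antiext\<close>.\<close>

lemma level_close:
  assumes s: "s > 0" and h: "h \<in> coarse01 k (s div 2)" and d: "\<bar>c - c'\<bar> \<le> int k"
  shows "\<bar>level s k h c - level s k h c'\<bar> \<le> 1"
proof -
  have hC: "h \<in> coarse k (s div 2)" using h unfolding coarse01_def by blast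
  have *: "\<bar>level s k h c - level s k h c'\<bar> \<le> 1" if cc: "c \<le> c'" "c' \<le> c + int k" for c c'
  proof -
    obtain r m where rm: "c = r + m * int (s + k)"
      "int (s div 2) - int (s + k) \<le> r" "r < int (s div 2)"
      using period_split[OF s] by blast
    define r' where "r' = c' - m * int (s + k)"
    have r': "c' = r' + m * int (s + k)" "r \<le> r'" "r' \<le> r + int k"
      using cc rm(1) unfolding r'_def by auto
    have "level s k h c = antiext h r - m"
      unfolding rm(1) using rm by (intro level_eq[OF s hC]) linarith+
    moreover have "level s k h c' = antiext h r' - m"
      unfolding r'(1) using rm(2,3) r'(2,3) by (intro level_eq[OF s hC]) linarith+
    ultimately show ?thesis using antiext_close[OF h, of r r'] r' by simp
  qed
  show ?thesis using *[of c c'] *[of c' c] d by linarith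
qed

lemma level_restrict:
  assumes s: "s > 0" and h: "h \<in> coarse k (s div 2)" and i: "i < s div 2"
  shows "level s k h (int i) = h i"
  using level_eq[OF s h, of "int i" 0] i by (simp add: antiext_def)

section \<open>Passing between level functions and sets of beads\<close>

definition level_maya :: "nat \<Rightarrow> nat \<Rightarrow> (nat \<Rightarrow> int) \<Rightarrow> int set" where
  "level_maya s k h = {z. 0 < level s k h z}"

text \<open>Subtracting \<open>s + k\<close> raises the level by 1, and every \<open>t\<close> in
  \<open>{s..s + 2 * k}\<close> is within \<open>k\<close> of \<open>s + k\<close>, so the level at
  \<open>z - t\<close> is still positive.\<close>

lemma level_maya_in:
  assumes s: "s > 0" and h: "h \<in> coarse01 k (s div 2)"
  shows "level_maya s k h \<in> core_mayas s k"
proof -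
  have hC: "h \<in> coarse k (s div 2)" using h unfolding coarse01_def by blast
  let ?N = "int (s + k)" and ?M = "int (s div 2)"
  have "\<exists>n. \<forall>z\<in>level_maya s k h. z < int n"
  proof -
    have "finite (antiext h ` {?M - ?N..<?M})" by simp
    then obtain B where B: "\<And>r. r \<in> {?M - ?N..<?M} \<Longrightarrow> antiext h r \<le> B"
      using Max_ge by (metis imageI)
    have "z < ?M + \<bar>B\<bar> * ?N" if z: "z \<in> level_maya s k h" for z
    proof -
      obtain r m where rm: "z = r + m * ?N" "?M - ?N \<le> r" "r < ?M"
        using period_split[OF s] by blast
      have "level s k h z = antiext h r - m"
        unfolding rm(1) using rm by (intro level_eq[OF s hC]) linarith+
      hence "m \<le> \<bar>B\<bar>" using z B[of r] rm unfolding level_maya_def by auto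
      hence "m * ?N \<le> \<bar>B\<bar> * ?N" by (intro mult_right_mono) simp_all
      thus ?thesis using rm by linarith
    qed
    moreover have "?M + \<bar>B\<bar> * ?N = int (nat (?M + \<bar>B\<bar> * ?N))" by simp
    ultimately show ?thesis by metis
  qed
  moreover have "z \<in> level_maya s k h \<longleftrightarrow> - 1 - z \<notin> level_maya s k h" for z
    using level_minus[OF s hC, of z] unfolding level_maya_def by auto
  moreover have "z - int t \<in> level_maya s k h"
    if t: "t \<in> {s..s + 2 * k}" and z: "z \<in> level_maya s k h" for t z
  proof -
    have "z - ?N = z + (- 1) * ?N" by simp
    hence "level s k h (z - ?N) = level s k h z - (- 1)"
      by (simp only: level_shift[OF s hC])
    moreover have "\<bar>level s k h (z - ?N) - level s k h (z - int t)\<bar> \<le> 1"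
      using t by (intro level_close[OF s h]) auto
    ultimately show ?thesis using z unfolding level_maya_def by auto
  qed
  ultimately show ?thesis unfolding core_mayas_def by blast
qed

text \<open>The set determines the levels: \<open>c + j * (s + k)\<close> belongs to it iff
  \<open>j\<close> is below the level of \<open>c\<close>.\<close>

lemma level_maya_inj:
  assumes s: "s > 0"
  shows "inj_on (level_maya s k) (coarse k (s div 2))"
proof (rule inj_onI)
  fix h h' assume h: "h \<in> coarse k (s div 2)" and h': "h' \<in> coarse k (s div 2)"
    and eq: "level_maya s k h = level_maya s k h'"
  have "j < level s k h c \<longleftrightarrow> j < level s k h' c" for c j
  proof -
    have "c + j * int (s + k) \<in> level_maya s k h \<longleftrightarrow> c + j * int (s + k) \<in> level_maya s k h'"
      using eq by simp
    thus ?thesis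
      unfolding level_maya_def using level_shift[OF s h, of c j] level_shift[OF s h', of c j] by simp
  qed
  hence lev: "level s k h c = level s k h' c" for c
    by (metis less_irrefl not_less_iff_gr_or_eq)
  show "h = h'"
  proof
    fix i show "h i = h' i"
    proof (cases "i < s div 2")
      case True
      thus ?thesis using level_restrict[OF s h] level_restrict[OF s h'] lev by metis
    qed (use h h' in \<open>simp add: coarse_def\<close>)
  qed
qed

text \<open>On a residue class modulo \<open>N\<close> the set is closed downwards, contains
  everything far to the left and nothing far to the right, so it is cut off at one point.\<close>

lemma threshold:
  fixes N :: int
  assumes N: "N > 0" and high: "\<And>z. z \<in> S \<Longrightarrow> z < n" and low: "\<And>z. z < - n \<Longrightarrow> z \<in> S"
    and closed: "\<And>z. z \<in> S \<Longrightarrow> z - N \<in> S"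
  obtains v where "\<And>j. c + j * N \<in> S \<longleftrightarrow> j < v"
proof -
  have down: "c + (j - int i) * N \<in> S" if "c + j * N \<in> S" for j i
  proof (induction i)
    case (Suc i)
    show ?case using closed[OF Suc] by (simp add: algebra_simps)
  qed (use that in simp)
  \<comment> \<open>Chosen so that \<open>c + j0 * N < - n\<close> and
    \<open>c - j0 * N \<ge> n\<close>, using \<open>N \<ge> 1\<close>.\<close>
  define j0 where "j0 = - (\<bar>n\<bar> + \<bar>c\<bar> + 1)"
  have "(- j0) * 1 \<le> (- j0) * N" using N unfolding j0_def by (intro mult_left_mono) auto
  hence far: "- j0 \<le> - (j0 * N)" by simp
  hence start: "c + j0 * N \<in> S" by (intro low) (use j0_def in linarith)
  have "c + (j0 + int (2 * nat (- j0))) * N \<notin> S"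
  proof -
    have "\<not> c - j0 * N < n" using far j0_def by linarith
    hence "c - j0 * N \<notin> S" using high by blast
    moreover have "j0 + int (2 * nat (- j0)) = - j0" unfolding j0_def by auto
    hence "c + (j0 + int (2 * nat (- j0))) * N = c - j0 * N" by (simp only:)
    ultimately show ?thesis by (simp only: simp_thms)
  qed
  then obtain m where m: "c + (j0 + int m) * N \<notin> S" "\<And>i. i < m \<Longrightarrow> c + (j0 + int i) * N \<in> S"
    using exists_least_iff[of "\<lambda>m. c + (j0 + int m) * N \<notin> S"] by blast
  have "c + j * N \<in> S \<longleftrightarrow> j < j0 + int m" for j
  proof
    assume "c + j * N \<in> S"
    thus "j < j0 + int m"
      using down[of j "nat (j - (j0 + int m))"] m(1) by (cases "j < j0 + int m") auto
  next
    assume j: "j < j0 + int m"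
    show "c + j * N \<in> S"
    proof (cases "j \<le> j0")
      case True
      thus ?thesis using down[OF start, of "nat (j0 - j)"] by simp
    next
      case False
      thus ?thesis using m(2)[of "nat (j - j0)"] j by simp
    qed
  qed
  thus thesis by (rule that)
qed

text \<open>With \<open>H c\<close> the cut-off on the class of \<open>c\<close>, the symmetries and
  core conditions of \<open>S\<close> become properties of \<open>H\<close>, and a truncation of
  \<open>H\<close> is the required sequence.\<close>

lemma level_maya_surj:
  assumes s: "s > 0" and k: "k > 0" and S: "S \<in> core_mayas s k"
  shows "S \<in> level_maya s k ` coarse01 k (s div 2)"
proof -
  let ?N = "int (s + k)" and ?M = "int (s div 2)"
  obtain n where n: "\<And>z. z \<in> S \<Longrightarrow> z < int n"
    using S unfolding core_mayas_def by blast
  have anti: "z \<in> S \<longleftrightarrow> - 1 - z \<notin> S" for z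
    using S unfolding core_mayas_def by blast
  have closed: "z - t \<in> S" if "z \<in> S" "int s \<le> t" "t \<le> int (s + 2 * k)" for z t
  proof -
    have "nat t \<in> {s..s + 2 * k}" using that by auto
    hence "z - int (nat t) \<in> S" using S that(1) unfolding core_mayas_def by blast
    thus ?thesis using that by simp
  qed
  have "\<exists>v. \<forall>j. c + j * ?N \<in> S \<longleftrightarrow> j < v" for c
  proof -
    have "z \<in> S" if "z < - int n" for z
      using anti[of z] n[of "- 1 - z"] that by auto
    then obtain v where "\<And>j. c + j * ?N \<in> S \<longleftrightarrow> j < v"
      using threshold[of ?N S "int n" c] n closed[of _ ?N] s by auto
    thus ?thesis by blast
  qed
  then obtain H where H: "\<And>c j. c + j * ?N \<in> S \<longleftrightarrow> j < H c" by metis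
  have eqI: "x = y" if "\<And>j. j < x \<longleftrightarrow> j < y" for x y :: int
    using that by (metis less_irrefl not_less_iff_gr_or_eq)
  have shift: "H (c + m * ?N) = H c - m" for c m
  proof (rule eqI)
    fix j
    have eq: "c + m * ?N + j * ?N = c + (m + j) * ?N" by (simp add: algebra_simps)
    have "j < H (c + m * ?N) \<longleftrightarrow> m + j < H c"
      unfolding H[symmetric] eq ..
    thus "j < H (c + m * ?N) \<longleftrightarrow> j < H c - m" by linarith
  qed
  have minus: "H (- 1 - c) = 1 - H c" for c
  proof (rule eqI)
    fix j
    have eq: "- 1 - (- 1 - c + j * ?N) = c + (- j) * ?N" by simp
    have "j < H (- 1 - c) \<longleftrightarrow> \<not> - j < H c"
      unfolding H[symmetric] eq[symmetric] by (rule anti)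
    thus "j < H (- 1 - c) \<longleftrightarrow> j < 1 - H c" by linarith
  qed
  \<comment> \<open>The topmost element of the class of \<open>c\<close> is
    \<open>c + (H c - 1) * N\<close>. Moving it down by \<open>N + c - c'\<close>, which lies
    between \<open>s\<close> and \<open>s + 2 * k\<close>, reaches the class of
    \<open>c'\<close>.\<close>
  have lower: "H c - 1 \<le> H c'" if "\<bar>c - c'\<bar> \<le> int k" for c c'
  proof -
    have "c + (H c - 1) * ?N \<in> S" unfolding H by simp
    hence mem: "c + (H c - 1) * ?N - (?N + c - c') \<in> S"
      using that by (intro closed) auto
    have eq: "c + (H c - 1) * ?N - (?N + c - c') = c' + (H c - 2) * ?N"
      by (simp add: algebra_simps)
    from mem have "c' + (H c - 2) * ?N \<in> S" unfolding eq .
    thus ?thesis unfolding H by simp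
  qed
  have close: "\<bar>H c - H c'\<bar> \<le> 1" if "\<bar>c - c'\<bar> \<le> int k" for c c'
    using lower[of c c'] lower[of c' c] that by linarith
  \<comment> \<open>The symmetries give \<open>H (N - 1 - c) = - H c\<close>. As \<open>c\<close>
    and \<open>N - 1 - c\<close> differ by at most \<open>k\<close>, twice \<open>H c\<close> is at
    most 1 in absolute value.\<close>
  have middle: "H c = 0" if "?M \<le> c" "c < ?N - ?M" for c
  proof -
    have "H (- 1 - c + 1 * ?N) = - H c" using shift[of "- 1 - c" 1] minus[of c] by simp
    moreover have "\<bar>c - (- 1 - c + 1 * ?N)\<bar> \<le> int k"
    proof -
      have "\<bar>c - (- 1 - c + 1 * (S + K))\<bar> \<le> K"
        if "S \<le> 2 * M + 1" "M \<le> c" "c < S + K - M" for S K M :: int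
        using that by arith
      from this[of "int s" ?M "int k"] show ?thesis using that by simp
    qed
    ultimately have "\<bar>H c + H c\<bar> \<le> 1" using close[of c "- 1 - c + 1 * ?N"] by simp
    thus ?thesis by linarith
  qed
  define h where "h = (\<lambda>i. if i < s div 2 then H (int i) else 0)"
  \<comment> \<open>From \<open>s div 2\<close> on both sides are 0, so truncation changes nothing
    up to the end of the middle range.\<close>
  have hH: "h i = H (int i)" if "int i < ?N - ?M" for i
    using middle[of "int i"] that unfolding h_def by auto
  have "h \<in> coarse k (s div 2)"
  proof -
    have "\<bar>h i - h j\<bar> \<le> 1" if "i \<le> j" "j \<le> i + k" for i j
    proof (cases "int j < ?N - ?M")
      case True
      thus ?thesis using hH[of i] hH[of j] close[of "int i" "int j"] that by simp
    next
      case False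
      \<comment> \<open>Here \<open>i \<ge> j - k \<ge> s - s div 2\<close>.\<close>
      hence "s div 2 \<le> i" "s div 2 \<le> j" using that by linarith+
      thus ?thesis unfolding h_def by simp
    qed
    thus ?thesis unfolding coarse_def h_def by simp
  qed
  moreover have "h i = 0 \<or> h i = 1" if "i < k" for i
  proof -
    \<comment> \<open>The values at 0 and \<open>- 1\<close> sum to 1 and differ by at most 1, so
      they are 0 and 1 in some order. An index \<open>i < k\<close> is within \<open>k\<close> of
      both positions.\<close>
    have "H (- 1) = 1 - H 0" using minus[of 0] by simp
    moreover have "\<bar>H 0 - H (- 1)\<bar> \<le> 1" "\<bar>H (int i) - H 0\<bar> \<le> 1" "\<bar>H (int i) - H (- 1)\<bar> \<le> 1"
      using that by (intro close; simp)+
    ultimately have "H (int i) = 0 \<or> H (int i) = 1" by linarith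
    thus ?thesis unfolding h_def by auto
  qed
  ultimately have h: "h \<in> coarse01 k (s div 2)" and hC: "h \<in> coarse k (s div 2)"
    unfolding coarse01_def by auto
  have "level s k h c = H c" for c
  proof -
    obtain r m where rm: "c = r + m * ?N" "?M - ?N \<le> r" "r < ?M"
      using period_split[OF s] by blast
    \<comment> \<open>For negative \<open>r\<close> in the window the mirror index
      \<open>- 1 - r\<close> is below \<open>N - s div 2\<close>, where \<open>h\<close> and
      \<open>H\<close> agree.\<close>
    have "antiext h r = H r"
    proof (cases "0 \<le> r")
      case True
      thus ?thesis using hH[of "nat r"] rm unfolding antiext_def by auto
    next
      case False
      thus ?thesis using hH[of "nat (- 1 - r)"] rm(2) minus[of r] unfolding antiext_def by auto
    qed
    moreover have "level s k h c = antiext h r - m"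
      unfolding rm(1) using rm by (intro level_eq[OF s hC]) linarith+
    ultimately show ?thesis using shift[of r m] rm(1) by simp
  qed
  hence "level_maya s k h = S"
    using H[of _ 0] unfolding level_maya_def by auto
  thus ?thesis using h by blast
qed

lemma card_core_mayas:
  assumes s: "s > 0" and k: "k > 0"
  shows "card (core_mayas s k) = card (coarse01 k (s div 2))"
proof -
  have "core_mayas s k = level_maya s k ` coarse01 k (s div 2)"
    using level_maya_in[OF s] level_maya_surj[OF s k] by blast
  moreover have "inj_on (level_maya s k) (coarse01 k (s div 2))"
    by (rule inj_on_subset[OF level_maya_inj[OF s]]) (auto simp: coarse01_def)
  ultimately show ?thesis by (simp add: card_image)
qed

theorem theorem2p22:
  fixes s k :: nat
  assumes "s > 0" and "k > 0"
  shows "card {p. is_partition p \<and> self_conjugate p \<and> simultaneous_core {s..s + 2 * k} p}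
       = card {vs. symmetric_dyck_path s (2 * k) vs}"
proof -
  \<comment> \<open>Both counts are the sum over \<open>i < k\<close> of the numbers of free paths
    of abscissa \<open>s div 2 - i\<close> ending at heights 0 and 1.\<close>
  have "int (card (coarse01 k (s div 2))) = int (card (half_paths s k))"
    using card_coarse01[OF assms(2), of "s div 2"] card_half_paths[OF assms(2), of s] by simp
  thus ?thesis
    using card_self_conjugate_cores[OF assms(1), of k] card_core_mayas[OF assms]
      card_symmetric_dyck_paths[OF assms(2), of s] by simp
qed

end
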